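(* Let $D$ be a bounded domain in $\mathbb{C}^n$. Then for any $x\in D$ there exists a holomorphic embedding $f: D\rightarrow B^n$ such that $f(x)=0$ and $B^n(0, s_D(x))\subset f(D)$.
   Context: $B^n$ is the open unit ball in $\mathbb{C}^n$ and $B^n(0,r)$ is the open ball with center $0$ and radius $r$. A holomorphic embedding $f:D\to B^n$ means an (open) injective holomorphic map. For a bounded domain $D\subset\mathbb{C}^n$, $p\in D$ and a holomorphic embedding $f: D\rightarrow B^n$ with $f(p)=0$, put $s_D(p,f)=\sup\{r : B^n(0,r)\subset f(D)\}$. The squeezing function of $D$ is $s_D(p)=\sup_f s_D(p,f)$, the supremum being over all holomorphic embeddings $f: D\rightarrow B^n$ with $f(p)=0$. *)

theory Defs
  imports "HOL-Analysis.Analysis"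
begin

definition bounded_domain :: "(complex ^ 'n) set \<Rightarrow> bool" where
  "bounded_domain D \<longleftrightarrow> D \<noteq> {} \<and> open D \<and> connected D \<and> bounded D"

text \<open>
  Complex differentiability at every point: the Frechet derivative is given by a complex
  (Jacobian) matrix, hence is complex-linear and not merely real-linear.
\<close>

definition holomorphic_map_on :: "(complex ^ 'n \<Rightarrow> complex ^ 'm) \<Rightarrow> (complex ^ 'n) set \<Rightarrow> bool" where
  "holomorphic_map_on f D \<longleftrightarrow>
     (\<forall>z\<in>D. \<exists>A :: complex ^ 'n ^ 'm. (f has_derivative (\<lambda>v. A *v v)) (at z))"

text \<open>
  Openness is automatic for an injective holomorphic map between open sets of the same
  dimension; it is listed since it belongs to the meaning of ``embedding''.
\<close>

definition holomorphic_embedding ::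
    "(complex ^ 'n) set \<Rightarrow> (complex ^ 'n) set \<Rightarrow> (complex ^ 'n \<Rightarrow> complex ^ 'n) \<Rightarrow> bool" where
  "holomorphic_embedding D E f \<longleftrightarrow>
     f ` D \<subseteq> E \<and> holomorphic_map_on f D \<and> inj_on f D \<and>
     (\<forall>U\<subseteq>D. open U \<longrightarrow> open (f ` U))"

text \<open>
  The norm on \<^typ>\<open>complex ^ 'n\<close> is the Hermitian one, so \<^term>\<open>ball (0 :: complex ^ 'n) 1\<close>
  is the unit ball of complex n-space. For a bounded domain \<open>D\<close>, \<open>p \<in> D\<close> and an embedding \<open>f\<close>
  of \<open>D\<close> into the unit ball with \<open>f p = 0\<close>, both suprema below are taken over nonempty sets of
  reals bounded above by 1: \<open>f ` D\<close> is an open neighbourhood of 0 inside the unit ball, and a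
  suitable \<open>z \<mapsto> c (z - p)\<close> is such an embedding.
\<close>

definition squeezing_at :: "(complex ^ 'n) set \<Rightarrow> (complex ^ 'n \<Rightarrow> complex ^ 'n) \<Rightarrow> real" where
  "squeezing_at D f = Sup {r. 0 < r \<and> ball 0 r \<subseteq> f ` D}"

definition squeezing_function :: "(complex ^ 'n) set \<Rightarrow> complex ^ 'n \<Rightarrow> real" where
  "squeezing_function D p =
     Sup {squeezing_at D f | f. holomorphic_embedding D (ball 0 1) f \<and> f p = 0}"

end

theory Submission
  imports Defs "HOL-Complex_Analysis.Great_Picard"
begin

text \<open>
  Take embeddings \<open>F n\<close> whose images contain balls of radius tending to \<open>s = s_D(x)\<close>. By Montel a
  subsequence converges to some \<open>f\<close>. The inverses \<open>G n\<close> map balls around 0 into the bounded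
  domain \<open>D\<close>, so they subconverge as well, to some \<open>g\<close> with \<open>f \<circ> g = id\<close> near 0. Hence neither
  Jacobian vanishes at the base point; by Hurwitz's theorem on complex lines neither vanishes
  anywhere, and a Brouwer argument makes \<open>f\<close> injective and forces \<open>g\<close> to take its values in \<open>D\<close>
  itself. Then \<open>f \<circ> g = id\<close> on the whole ball.

  Holomorphy of the \<open>G n\<close> is Osgood's theorem, that an injective holomorphic map \<open>f\<close> between open
  sets of equal dimension has a nonzero Jacobian. With \<open>h = det f' \<circ> f\<^sup>-\<^sup>1\<close>, which is continuous and
  holomorphic where it does not vanish, the maximum principle for \<open>u\<^sup>n h\<close> as \<open>n \<rightarrow> \<infinity>\<close> yields a
  Schwarz lemma for \<open>f\<^sup>-\<^sup>1\<close> along complex lines that ignores the zeros of \<open>h\<close>. So \<open>f\<^sup>-\<^sup>1\<close> is locally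
  Lipschitz, which makes \<open>f'\<close> injective.
\<close>

section \<open>Holomorphic functions of several variables\<close>

text \<open>The inverses \<open>G n\<close> are at first only continuous. Boundedness of
  \<open>D\<close> yields a convergent subsequence only once Osgood's theorem has made them
  holomorphic. Their limit \<open>g\<close> could a priori touch the boundary of \<open>D\<close>,
  where nothing is known about \<open>f\<close>. So \<open>f \<circ> g = id\<close> is first
  available only near 0, because \<open>g 0 = x\<close> is an interior point. In Osgood's theorem
  the Schwarz estimate compares only pairs of points at which \<open>h\<close> is nonzero. It
  spreads to all pairs because such points are dense, which is a separate argument with Jacobians.
  The calculus of several variables is drawn from one variable by restriction to complex lines:
  continuity together with holomorphy on every line characterises holomorphic functions, and this
  form of the notion passes to limits at once. No single \<open>F n\<close> needs to cover the ball
  of radius \<open>s\<close>, so covering is proved for each radius \<open>t < s\<close>, always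
  with the same limit \<open>f\<close>.\<close>

lemma norm_smult_complex:
  fixes v :: "complex ^ 'n"
  shows "norm (c *s v) = norm c * norm v"
  by (simp add: norm_vec_def L2_set_def norm_mult power_mult_distrib real_sqrt_mult
      flip: sum_distrib_left)

lemma bounded_linear_smult_left: "bounded_linear (\<lambda>t. t *s (v :: complex ^ 'n))"
  by (rule bounded_linear_intro[where K = "norm v"])
    (auto simp: vec_eq_iff algebra_simps norm_smult_complex)

lemma scaleR_eq_smult: "r *\<^sub>R (v :: complex ^ 'n) = complex_of_real r *s v"
  unfolding vec_eq_iff vector_scaleR_component vector_smult_component
  by (simp add: scaleR_conv_of_real)

lemma complex_line_has_derivative:
  "((\<lambda>t. a + t *s (v :: complex ^ 'n)) has_derivative (\<lambda>t. t *s v)) (at t0)"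
  using has_derivative_add[OF has_derivative_const
      bounded_linear_imp_has_derivative[OF bounded_linear_smult_left]] by simp

lemma continuous_on_complex_line: "continuous_on A (\<lambda>t. a + t *s (v :: complex ^ 'n))"
  by (intro continuous_at_imp_continuous_on ballI
      has_derivative_continuous[OF complex_line_has_derivative])

lemma open_complex_line:
  fixes a v :: "complex ^ 'n"
  assumes "open S"
  shows "open {t. a + t *s v \<in> S}"
  using open_vimage[OF assms continuous_on_complex_line[of UNIV a v]] by (simp add: vimage_def)

text \<open>Complex linearity of \<open>L\<close> is expressed by homogeneity alone; additivity is
  already part of \<open>has_derivative\<close>.\<close>

definition holo :: "(complex ^ 'n \<Rightarrow> complex) \<Rightarrow> (complex ^ 'n) set \<Rightarrow> bool" where
  "holo \<phi> S \<longleftrightarrow>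
     (\<forall>z\<in>S. \<exists>L. (\<phi> has_derivative L) (at z) \<and> (\<forall>c v. L (c *s v) = c * L v))"

text \<open>A one-variable derivative along a complex line. It makes sense before total
  differentiability is known, and one-variable estimates apply to it directly.\<close>

definition dir_deriv :: "(complex ^ 'n \<Rightarrow> complex) \<Rightarrow> complex ^ 'n \<Rightarrow> complex ^ 'n \<Rightarrow> complex" where
  "dir_deriv \<phi> v z = deriv (\<lambda>t. \<phi> (z + t *s v)) 0"

definition jac :: "(complex ^ 'n \<Rightarrow> complex ^ 'm) \<Rightarrow> complex ^ 'n \<Rightarrow> complex ^ 'n ^ 'm" where
  "jac f z = (\<chi> i j. dir_deriv (\<lambda>z. f z $ i) (axis j 1) z)"

lemma has_field_derivative_along_line:
  fixes a v :: "complex ^ 'n"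
  assumes "(\<phi> has_derivative L) (at (a + t *s v))" "\<And>c v. L (c *s v) = c * L v"
  shows "((\<lambda>t. \<phi> (a + t *s v)) has_field_derivative L v) (at t)"
  using has_derivative_compose[OF complex_line_has_derivative[where a = a] assms(1)] assms(2)
  by (simp add: has_field_derivative_def mult.commute[of _ "L v"])

lemma dir_deriv_eq:
  fixes z v :: "complex ^ 'n"
  assumes "(\<phi> has_derivative L) (at z)" "\<And>c v. L (c *s v) = c * L v"
  shows "dir_deriv \<phi> v z = L v"
  unfolding dir_deriv_def using has_field_derivative_along_line[of \<phi> L z 0 v] assms
  by (intro DERIV_imp_deriv) simp

lemma holo_has_derivative:
  assumes "holo \<phi> S" "z \<in> S"
  shows "(\<phi> has_derivative (\<lambda>v. dir_deriv \<phi> v z)) (at z)"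
    and "dir_deriv \<phi> (c *s v) z = c * dir_deriv \<phi> v z"
    and "dir_deriv \<phi> (u + v) z = dir_deriv \<phi> u z + dir_deriv \<phi> v z"
proof -
  obtain L where L: "(\<phi> has_derivative L) (at z)" "\<And>c v. L (c *s v) = c * L v"
    using assms unfolding holo_def by blast
  have eq: "dir_deriv \<phi> v z = L v" for v
    by (rule dir_deriv_eq[OF L])
  show "(\<phi> has_derivative (\<lambda>v. dir_deriv \<phi> v z)) (at z)"
    unfolding eq using L(1) by simp
  show "dir_deriv \<phi> (c *s v) z = c * dir_deriv \<phi> v z"
    unfolding eq by (rule L(2))
  show "dir_deriv \<phi> (u + v) z = dir_deriv \<phi> u z + dir_deriv \<phi> v z"
    unfolding eq using has_derivative_bounded_linear[OF L(1)]
    by (simp add: linear_add bounded_linear.linear)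
qed

lemma holo_continuous_on: "holo \<phi> S \<Longrightarrow> continuous_on S \<phi>"
  by (meson continuous_at_imp_continuous_on has_derivative_continuous holo_has_derivative(1))

lemma holo_line_has_field_derivative:
  fixes a v :: "complex ^ 'n"
  assumes "holo \<phi> S" "a + t *s v \<in> S"
  shows "((\<lambda>t. \<phi> (a + t *s v)) has_field_derivative dir_deriv \<phi> v (a + t *s v)) (at t)"
  using has_field_derivative_along_line[OF holo_has_derivative(1)[OF assms]]
    holo_has_derivative(2)[OF assms] by simp

lemma holo_line_holomorphic:
  assumes "holo \<phi> S"
  shows "(\<lambda>t. \<phi> (a + t *s v)) holomorphic_on {t. a + t *s v \<in> S}"
  unfolding holomorphic_on_def field_differentiable_def
  using holo_line_has_field_derivative[OF assms] has_field_derivative_at_within by blast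

lemma vec_eq_sum_axis: "(v :: complex ^ 'n) = (\<Sum>j\<in>UNIV. v $ j *s axis j 1)"
  by (simp add: vec_eq_iff axis_def mult_delta_right)

lemma dir_deriv_eq_sum:
  assumes "holo \<phi> S" "z \<in> S"
  shows "dir_deriv \<phi> v z = (\<Sum>j\<in>UNIV. dir_deriv \<phi> (axis j 1) z * v $ j)"
proof -
  have lin: "linear (\<lambda>v. dir_deriv \<phi> v z)"
    using has_derivative_linear[OF holo_has_derivative(1)[OF assms]] .
  have "dir_deriv \<phi> (\<Sum>j\<in>UNIV. v $ j *s axis j 1) z = (\<Sum>j\<in>UNIV. dir_deriv \<phi> (v $ j *s axis j 1) z)"
    by (rule linear_sum[OF lin])
  then show ?thesis
    unfolding vec_eq_sum_axis[of v, symmetric] holo_has_derivative(2)[OF assms]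
    by (simp add: mult.commute)
qed

lemma has_derivative_vec_componentwise:
  fixes f :: "'a::real_normed_vector \<Rightarrow> complex ^ 'm"
  assumes "\<And>i. ((\<lambda>x. f x $ i) has_derivative (\<lambda>v. f' v $ i)) (at z)"
  shows "(f has_derivative f') (at z)"
proof -
  have "((\<lambda>x. \<Sum>i\<in>UNIV. f x $ i *s axis i 1) has_derivative
          (\<lambda>v. \<Sum>i\<in>UNIV. f' v $ i *s axis i 1)) (at z)"
    by (intro has_derivative_sum bounded_linear.has_derivative[OF bounded_linear_smult_left] assms)
  then show ?thesis
    unfolding vec_eq_sum_axis[symmetric] .
qed

lemma jac_mult_component:
  assumes "holo (\<lambda>z. f z $ i) S" "z \<in> S"
  shows "(jac f z *v v) $ i = dir_deriv (\<lambda>z. f z $ i) v z"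
  using dir_deriv_eq_sum[OF assms, of v] by (simp add: jac_def matrix_vector_mult_def)

lemma holomorphic_map_on_iff_holo:
  "holomorphic_map_on f S \<longleftrightarrow> (\<forall>i. holo (\<lambda>z. f z $ i) S)"
proof
  assume f: "holomorphic_map_on f S"
  show "\<forall>i. holo (\<lambda>z. f z $ i) S"
    unfolding holo_def
  proof (intro allI ballI)
    fix i z assume "z \<in> S"
    then obtain A where A: "(f has_derivative (*v) A) (at z)"
      using f unfolding holomorphic_map_on_def by blast
    have "((\<lambda>z. f z $ i) has_derivative (\<lambda>v. (A *v v) $ i)) (at z)"
      by (rule bounded_linear.has_derivative[OF bounded_linear_vec_nth A])
    then show "\<exists>L. ((\<lambda>z. f z $ i) has_derivative L) (at z) \<and> (\<forall>c v. L (c *s v) = c * L v)"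
      by (intro exI conjI) (auto simp: vec.scale)
  qed
next
  assume f: "\<forall>i. holo (\<lambda>z. f z $ i) S"
  show "holomorphic_map_on f S"
    unfolding holomorphic_map_on_def
  proof (intro ballI exI)
    fix z assume z: "z \<in> S"
    show "(f has_derivative (*v) (jac f z)) (at z)"
      using f z jac_mult_component[of f _ S z] holo_has_derivative(1)[OF _ z]
      by (intro has_derivative_vec_componentwise) simp
  qed
qed

lemma jac_unique:
  assumes "(f has_derivative (*v) A) (at z)"
  shows "jac f z = A"
proof -
  have "dir_deriv (\<lambda>z. f z $ i) v z = (A *v v) $ i" for i v
    by (rule dir_deriv_eq[OF bounded_linear.has_derivative[OF bounded_linear_vec_nth assms]])
      (simp add: vec.scale)
  then show ?thesis
    by (simp add: jac_def vec_eq_iff matrix_vector_mult_def axis_def mult_delta_right)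
qed

lemma holomorphic_map_on_has_derivative:
  assumes "holomorphic_map_on f S" "z \<in> S"
  shows "(f has_derivative (*v) (jac f z)) (at z)"
  using assms jac_unique unfolding holomorphic_map_on_def by metis

lemma holomorphic_map_on_continuous_on: "holomorphic_map_on f S \<Longrightarrow> continuous_on S f"
  by (meson continuous_at_imp_continuous_on has_derivative_continuous
      holomorphic_map_on_has_derivative)

lemma holomorphic_map_on_subset:
  "holomorphic_map_on f S \<Longrightarrow> T \<subseteq> S \<Longrightarrow> holomorphic_map_on f T"
  unfolding holomorphic_map_on_def by blast

lemma holo_compose:
  assumes "holomorphic_map_on g S" "holo \<phi> T" "g ` S \<subseteq> T"
  shows "holo (\<lambda>z. \<phi> (g z)) S"
  unfolding holo_def
proof (intro ballI exI conjI allI)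
  fix z assume z: "z \<in> S"
  with assms have gz: "g z \<in> T" by blast
  show "((\<lambda>z. \<phi> (g z)) has_derivative (\<lambda>v. dir_deriv \<phi> (jac g z *v v) (g z))) (at z)"
    by (rule has_derivative_compose[OF holomorphic_map_on_has_derivative[OF assms(1) z]
          holo_has_derivative(1)[OF assms(2) gz]])
  show "dir_deriv \<phi> (jac g z *v (c *s v)) (g z) = c * dir_deriv \<phi> (jac g z *v v) (g z)" for c v
    using holo_has_derivative(2)[OF assms(2) gz] by (simp add: vec.scale)
qed

lemma jac_compose:
  assumes "holomorphic_map_on f S" "z \<in> S" "holomorphic_map_on g T" "f z \<in> T"
  shows "jac (\<lambda>z. g (f z)) z = jac g (f z) ** jac f z"
proof (rule jac_unique)
  show "((\<lambda>z. g (f z)) has_derivative (*v) (jac g (f z) ** jac f z)) (at z)"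
    using has_derivative_compose[OF holomorphic_map_on_has_derivative[OF assms(1,2)]
        holomorphic_map_on_has_derivative[OF assms(3,4)]]
    by (simp add: matrix_vector_mul_assoc)
qed

section \<open>Maximum principle and Schwarz lemma off a zero set\<close>

text \<open>The set where \<open>h\<close> is nonzero has two kinds of frontier points: zeros of
  \<open>h\<close>, where \<open>G z ^ n * h z\<close> vanishes, and points of the sphere. So this
  product is bounded by \<open>M ^ n * K\<close> throughout, and the factor
  \<open>K / cmod (h a)\<close> is beaten by large powers.\<close>

lemma max_principle_off_zeros:
  fixes G h :: "complex \<Rightarrow> complex"
  assumes contG: "continuous_on (cball 0 R) G" and conth: "continuous_on (cball 0 R) h"
    and holG: "G holomorphic_on {z \<in> ball 0 R. h z \<noteq> 0}"
    and holh: "h holomorphic_on {z \<in> ball 0 R. h z \<noteq> 0}"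
    and M: "\<And>z. z \<in> sphere 0 R \<Longrightarrow> cmod (G z) \<le> M"
    and a: "a \<in> ball 0 R" "h a \<noteq> 0"
  shows "cmod (G a) \<le> M"
proof -
  define W where "W = {z \<in> ball 0 R. h z \<noteq> 0}"
  have "open (ball 0 R \<inter> h -` (- {0}))"
    by (rule continuous_open_preimage[OF continuous_on_subset[OF conth]]) auto
  also have "ball 0 R \<inter> h -` (- {0}) = W"
    by (auto simp: W_def)
  finally have "open W" .
  have R: "R > 0"
    using a by (auto intro: le_less_trans[OF norm_ge_zero])
  have clW: "closure W \<subseteq> cball 0 R"
    by (rule closure_minimal) (auto simp: W_def)
  have M0: "0 \<le> M"
    using order_trans[OF norm_ge_zero M[of "of_real R"]] R by simp
  have "bounded (h ` cball 0 R)"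
    using compact_continuous_image[OF conth compact_cball] compact_imp_bounded by blast
  then obtain K where K: "\<And>z. z \<in> cball 0 R \<Longrightarrow> cmod (h z) \<le> K"
    unfolding bounded_iff by blast
  have bound: "cmod (G a) ^ n * cmod (h a) \<le> M ^ n * K" for n
  proof -
    have "cmod ((\<lambda>z. G z ^ n * h z) a) \<le> M ^ n * K"
    proof (rule maximum_modulus_frontier[where S = W and \<xi> = a and f = "\<lambda>z. G z ^ n * h z"])
      show "(\<lambda>z. G z ^ n * h z) holomorphic_on interior W"
        using holG holh \<open>open W\<close> by (auto simp: W_def interior_open intro!: holomorphic_intros)
      show "continuous_on (closure W) (\<lambda>z. G z ^ n * h z)"
        using continuous_on_subset[OF contG clW] continuous_on_subset[OF conth clW]
        by (intro continuous_intros)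
      show "bounded W"
        by (rule bounded_subset[OF bounded_ball[of 0 R]]) (auto simp: W_def)
      show "a \<in> W"
        using a by (simp add: W_def)
      fix z assume z: "z \<in> frontier W"
      then have zc: "z \<in> cball 0 R" and "z \<notin> W"
        using clW \<open>open W\<close> by (auto simp: frontier_def interior_open)
      then consider "h z = 0" | "z \<in> sphere 0 R"
        by (force simp: W_def)
      then show "cmod (G z ^ n * h z) \<le> M ^ n * K"
      proof cases
        case 1
        then show ?thesis
          using M0 K[OF zc] by simp
      next
        case 2
        then show ?thesis
          unfolding norm_mult norm_power using M[OF 2] M0 K[OF zc]
          by (intro mult_mono power_mono) auto
      qed
    qed
    then show ?thesis
      by (simp add: norm_mult norm_power)
  qed
  show ?thesis
  proof (rule ccontr)
    assume "\<not> ?thesis"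
    then have less: "M < cmod (G a)" by simp
    show False
    \<comment> \<open>The comparison of powers divides by \<open>M\<close>; for \<open>M = 0\<close>
      the exponent 1 already forces \<open>G a = 0\<close>.\<close>
    proof (cases "M = 0")
      case True
      then show False
        using bound[of 1] a less by (simp add: mult_le_0_iff)
    next
      case False
      with M0 have "0 < M" by simp
      with less have "1 < cmod (G a) / M" by simp
      from real_arch_pow[OF this, of "K / cmod (h a)"]
      obtain n where "K / cmod (h a) < (cmod (G a) / M) ^ n" by blast
      then have "M ^ n * K < cmod (G a) ^ n * cmod (h a)"
        using a \<open>0 < M\<close> by (simp add: power_divide field_simps)
      with bound[of n] show False by simp
    qed
  qed
qed

text \<open>The difference quotient at 0 with its removable singularity filled in.\<close>

definition dquot :: "(complex \<Rightarrow> complex) \<Rightarrow> complex \<Rightarrow> complex" where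
  "dquot u z = (if z = 0 then deriv u 0 else (u z - u 0) / z)"

text \<open>On the sphere the numerator is at most \<open>2 * M\<close> and the denominator is
  \<open>R\<close>; \<open>max_principle_off_zeros\<close> carries this bound inside, past the zeros
  of \<open>h\<close>.\<close>

lemma dquot_off_zeros:
  assumes R: "R > 0" and contu: "continuous_on (cball 0 R) u"
    and conth: "continuous_on (cball 0 R) h"
    and holu: "u holomorphic_on {z \<in> ball 0 R. h z \<noteq> 0}"
    and holh: "h holomorphic_on {z \<in> ball 0 R. h z \<noteq> 0}"
    and M: "\<And>z. z \<in> cball 0 R \<Longrightarrow> cmod (u z) \<le> M" and h0: "h 0 \<noteq> 0"
  shows "continuous_on (cball 0 R) (dquot u)"
    and "dquot u holomorphic_on {z \<in> ball 0 R. h z \<noteq> 0}"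
    and "\<And>z. \<lbrakk>z \<in> cball 0 R; h z \<noteq> 0\<rbrakk> \<Longrightarrow> cmod (dquot u z) \<le> 2 * M / R"
proof -
  define W where "W = {z \<in> ball 0 R. h z \<noteq> 0}"
  have "open (ball 0 R \<inter> h -` (- {0}))"
    by (rule continuous_open_preimage[OF continuous_on_subset[OF conth]]) auto
  also have "ball 0 R \<inter> h -` (- {0}) = W"
    by (auto simp: W_def)
  finally have "open W" .
  have W0: "0 \<in> W"
    using R h0 by (simp add: W_def)
  \<comment> \<open>\<open>h 0 \<noteq> 0\<close> puts 0 into the open set \<open>W\<close>, so the
    singularity at 0 is an interior one and can be removed.\<close>
  show hol: "dquot u holomorphic_on {z \<in> ball 0 R. h z \<noteq> 0}"
    using pole_lemma[OF holu[folded W_def], of 0] W0 \<open>open W\<close>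
    unfolding W_def[symmetric] by (simp add: interior_open dquot_def[abs_def] cong: if_cong)
  \<comment> \<open>Continuity is glued from two relatively open pieces: \<open>W\<close>, which
    contains 0, and the punctured closed disc, where the plain quotient formula holds.\<close>
  have Un: "W \<union> (cball 0 R - {0}) = cball 0 R"
    using W0 by (auto simp: W_def)
  have "continuous_on (W \<union> (cball 0 R - {0})) (dquot u)"
  proof (rule continuous_on_Un_local_open)
    show "openin (top_of_set (W \<union> (cball 0 R - {0}))) W"
      using \<open>open W\<close> by (auto simp: open_subset)
    show "openin (top_of_set (W \<union> (cball 0 R - {0}))) (cball 0 R - {0})"
      unfolding Un by (simp add: openin_delete)
    show "continuous_on W (dquot u)"
      using hol holomorphic_on_imp_continuous_on unfolding W_def by blast
    have "continuous_on (cball 0 R - {0}) (\<lambda>z. (u z - u 0) / z)"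
      using continuous_on_subset[OF contu] by (auto intro!: continuous_intros)
    then show "continuous_on (cball 0 R - {0}) (dquot u)"
      by (rule continuous_on_eq) (simp add: dquot_def)
  qed
  then show cont: "continuous_on (cball 0 R) (dquot u)"
    unfolding Un .
  have sph: "cmod (dquot u z) \<le> 2 * M / R" if "z \<in> sphere 0 R" for z
  proof -
    have "cmod (u z - u 0) \<le> M + M"
      using that R by (intro norm_triangle_le_diff add_mono M) auto
    then show ?thesis
      using that R by (auto simp: dquot_def norm_divide divide_right_mono)
  qed
  show "cmod (dquot u z) \<le> 2 * M / R" if "z \<in> cball 0 R" "h z \<noteq> 0" for z
  proof (cases "z \<in> sphere 0 R")
    case False
    show ?thesis
      by (rule max_principle_off_zeros[OF cont conth hol holh sph]) (use that False in auto)
  qed (rule sph)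
qed

lemma schwarz_off_zeros:
  assumes "R > 0" "continuous_on (cball 0 R) u" "continuous_on (cball 0 R) h"
    and "u holomorphic_on {z \<in> ball 0 R. h z \<noteq> 0}"
    and "h holomorphic_on {z \<in> ball 0 R. h z \<noteq> 0}"
    and "\<And>z. z \<in> cball 0 R \<Longrightarrow> cmod (u z) \<le> M" "h 0 \<noteq> 0" "z \<in> cball 0 R" "h z \<noteq> 0"
  shows "cmod (u z - u 0) \<le> 2 * M / R * cmod z"
proof (cases "z = 0")
  case False
  then show ?thesis
    using dquot_off_zeros(3)[OF assms] by (simp add: dquot_def norm_divide field_simps)
qed simp

text \<open>The case \<open>h = 1\<close>. Applying \<open>dquot\<close> twice gives the
  second-order Taylor remainder divided by \<open>z\<^sup>2\<close>, and each application costs a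
  factor \<open>2 / R\<close>.\<close>

lemma disc_estimates:
  assumes R: "R > 0" and contu: "continuous_on (cball 0 R) u" and holu: "u holomorphic_on ball 0 R"
    and M: "\<And>z. z \<in> cball 0 R \<Longrightarrow> cmod (u z) \<le> M"
  shows "cmod (deriv u 0) \<le> 2 * M / R"
    and "z \<in> cball 0 R \<Longrightarrow> cmod (u z - u 0) \<le> 2 * M / R * cmod z"
    and "z \<in> cball 0 R \<Longrightarrow>
           cmod (u z - u 0 - z * deriv u 0) \<le> 4 * M / R\<^sup>2 * (cmod z)\<^sup>2"
proof -
  have W: "{z \<in> ball 0 R. (1 :: complex) \<noteq> 0} = ball 0 R" by auto
  have q1: "continuous_on (cball 0 R) (dquot u)" "dquot u holomorphic_on ball 0 R"
    and q2: "\<And>z. z \<in> cball 0 R \<Longrightarrow> cmod (dquot u z) \<le> 2 * M / R"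
    using dquot_off_zeros[where h = "\<lambda>_. 1", OF R contu _ _ _ M] holu unfolding W by auto
  have q3: "cmod (dquot (dquot u) z) \<le> 2 * (2 * M / R) / R" if "z \<in> cball 0 R" for z
    using dquot_off_zeros(3)[where h = "\<lambda>_. 1", OF R q1(1) _ _ _ q2] that q1 unfolding W by auto
  show "cmod (deriv u 0) \<le> 2 * M / R"
    using q2[of 0] R by (simp add: dquot_def)
  show "cmod (u z - u 0) \<le> 2 * M / R * cmod z" if "z \<in> cball 0 R"
    using q2[OF that] by (cases "z = 0") (simp_all add: dquot_def norm_divide field_simps)
  show "cmod (u z - u 0 - z * deriv u 0) \<le> 4 * M / R\<^sup>2 * (cmod z)\<^sup>2" if "z \<in> cball 0 R"
  proof (cases "z = 0")
    case False
    then have eq: "u z - u 0 - z * deriv u 0 = dquot (dquot u) z * z\<^sup>2"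
      by (simp add: dquot_def field_simps power2_eq_square)
    show ?thesis
      unfolding eq norm_mult norm_power using q3[OF that]
      by (intro mult_right_mono) (simp_all add: power2_eq_square)
  qed simp
qed

section \<open>Holomorphy on complex lines\<close>

text \<open>A weak form of holomorphy to which theorems of one variable apply line by line. On open
  sets it turns out to be equivalent to \<open>holo\<close>.\<close>

definition line_holo :: "(complex ^ 'n \<Rightarrow> complex) \<Rightarrow> (complex ^ 'n) set \<Rightarrow> bool" where
  "line_holo \<phi> S \<longleftrightarrow>
     continuous_on S \<phi> \<and> (\<forall>a v. (\<lambda>t. \<phi> (a + t *s v)) holomorphic_on {t. a + t *s v \<in> S})"

lemma holo_imp_line_holo: "holo \<phi> S \<Longrightarrow> line_holo \<phi> S"
  unfolding line_holo_def using holo_line_holomorphic holo_continuous_on by blast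

lemma line_holo_subset: "line_holo \<phi> S \<Longrightarrow> T \<subseteq> S \<Longrightarrow> line_holo \<phi> T"
  unfolding line_holo_def
  by (meson Collect_mono continuous_on_subset holomorphic_on_subset subsetD)

lemma line_holo_diff:
  "line_holo \<phi> S \<Longrightarrow> line_holo \<psi> S \<Longrightarrow> line_holo (\<lambda>z. \<phi> z - \<psi> z) S"
  unfolding line_holo_def by (auto intro!: continuous_intros holomorphic_intros)

lemma line_holo_translate:
  assumes "line_holo \<phi> S" "\<And>z. z \<in> T \<Longrightarrow> z + d \<in> S"
  shows "line_holo (\<lambda>z. \<phi> (z + d)) T"
  unfolding line_holo_def
proof (intro conjI allI)
  show "continuous_on T (\<lambda>z. \<phi> (z + d))"
    using assms unfolding line_holo_def
    by (intro continuous_on_compose2[of S \<phi> T "\<lambda>z. z + d"]) (auto intro!: continuous_intros)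
  fix a v
  have "(\<lambda>t. \<phi> ((a + d) + t *s v)) holomorphic_on {t. a + t *s v \<in> T}"
    using assms unfolding line_holo_def
    by (elim conjE allE[of _ "a + d"] allE[of _ v] holomorphic_on_subset) (force simp: algebra_simps)
  then show "(\<lambda>t. \<phi> (a + t *s v + d)) holomorphic_on {t. a + t *s v \<in> T}"
    by (simp add: algebra_simps)
qed

lemma line_holo_dir_deriv:
  assumes "line_holo \<phi> S" "open S" "z \<in> S"
  shows "((\<lambda>t. \<phi> (z + t *s v)) has_field_derivative dir_deriv \<phi> v z) (at 0)"
  unfolding dir_deriv_def using assms open_complex_line[OF assms(2), of z v]
  by (intro holomorphic_derivI[where S = "{t. z + t *s v \<in> S}"]) (auto simp: line_holo_def)

lemma cball_estimates:
  assumes \<phi>: "line_holo \<phi> S" and R: "R > 0" and sub: "cball z R \<subseteq> S"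
    and M: "\<And>w. w \<in> cball z R \<Longrightarrow> cmod (\<phi> w) \<le> M"
  shows "cmod (dir_deriv \<phi> v z) \<le> 2 * M / R * norm v"
    and "norm v \<le> R \<Longrightarrow> cmod (\<phi> (z + v) - \<phi> z) \<le> 2 * M / R * norm v"
    and "norm v \<le> R \<Longrightarrow> cmod (\<phi> (z + v) - \<phi> z - dir_deriv \<phi> v z) \<le> 4 * M / R\<^sup>2 * (norm v)\<^sup>2"
proof -
  have "cmod (dir_deriv \<phi> v z) \<le> 2 * M / R * norm v \<and>
    (norm v \<le> R \<longrightarrow> cmod (\<phi> (z + v) - \<phi> z) \<le> 2 * M / R * norm v) \<and>
    (norm v \<le> R \<longrightarrow> cmod (\<phi> (z + v) - \<phi> z - dir_deriv \<phi> v z) \<le> 4 * M / R\<^sup>2 * (norm v)\<^sup>2)"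
  proof (cases "v = 0")
    case True
    then show ?thesis by (simp add: dir_deriv_def)
  next
    case False
    \<comment> \<open>The radius of the disc of parameters that stay in \<open>cball z R\<close>;
      the point \<open>z + v\<close> has parameter 1.\<close>
    define r where "r = R / norm v"
    have r: "r > 0"
      using False R by (simp add: r_def)
    define u where "u = (\<lambda>t. \<phi> (z + t *s v))"
    have mem: "z + t *s v \<in> cball z R" if "t \<in> cball 0 r" for t
      using that False by (simp add: r_def dist_norm norm_smult_complex field_simps)
    have contu: "continuous_on (cball 0 r) u"
      unfolding u_def using \<phi> sub mem unfolding line_holo_def
      by (intro continuous_on_compose2[OF _ continuous_on_complex_line]) blast+
    have holu: "u holomorphic_on ball 0 r"
      unfolding u_def using \<phi> sub mem unfolding line_holo_def
      by (elim conjE allE[of _ z] allE[of _ v] holomorphic_on_subset) force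
    note est = disc_estimates[OF r contu holu, of M]
    have u: "u 1 = \<phi> (z + v)" "u 0 = \<phi> z" "deriv u 0 = dir_deriv \<phi> v z"
      by (simp_all add: u_def dir_deriv_def)
    have 1: "2 * M / r = 2 * M / R * norm v" "4 * M / r\<^sup>2 = 4 * M / R\<^sup>2 * (norm v)\<^sup>2"
      by (simp_all add: r_def power_divide)
    have "1 \<in> cball (0 :: complex) r" if "norm v \<le> R"
      using that False by (simp add: r_def)
    then show ?thesis
      using est(1) est(2,3)[of 1] M[OF mem] unfolding u_def[symmetric] u 1
      by (simp add: u_def)
  qed
  then show "cmod (dir_deriv \<phi> v z) \<le> 2 * M / R * norm v"
    and "norm v \<le> R \<Longrightarrow> cmod (\<phi> (z + v) - \<phi> z) \<le> 2 * M / R * norm v"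
    and "norm v \<le> R \<Longrightarrow> cmod (\<phi> (z + v) - \<phi> z - dir_deriv \<phi> v z) \<le> 4 * M / R\<^sup>2 * (norm v)\<^sup>2"
    by blast+
qed

lemma dir_deriv_diff:
  assumes "line_holo \<phi> S" "line_holo \<psi> S" "open S" "z \<in> S"
  shows "dir_deriv (\<lambda>z. \<phi> z - \<psi> z) v z = dir_deriv \<phi> v z - dir_deriv \<psi> v z"
  unfolding dir_deriv_def[of "\<lambda>z. \<phi> z - \<psi> z"]
  by (intro DERIV_imp_deriv DERIV_diff line_holo_dir_deriv[OF _ assms(3,4)] assms(1,2))

lemma dir_deriv_translate: "dir_deriv (\<lambda>z. \<phi> (z + d)) v z = dir_deriv \<phi> v (z + d)"
  by (simp add: dir_deriv_def algebra_simps)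

lemma dir_deriv_smult:
  assumes "line_holo \<phi> S" "open S" "z \<in> S"
  shows "dir_deriv \<phi> (c *s v) z = c * dir_deriv \<phi> v z"
proof -
  have "((\<lambda>t. t * c) has_field_derivative c) (at 0)"
    by (auto intro!: derivative_eq_intros)
  moreover have "((\<lambda>t. \<phi> (z + t *s v)) has_field_derivative dir_deriv \<phi> v z) (at (0 * c))"
    using line_holo_dir_deriv[OF assms, of v] by simp
  ultimately have "((\<lambda>t. \<phi> (z + (t * c) *s v)) has_field_derivative dir_deriv \<phi> v z * c) (at 0)"
    by (rule DERIV_chain2[rotated])
  then show ?thesis
    unfolding dir_deriv_def[of \<phi> "c *s v"] by (intro DERIV_imp_deriv) (simp add: mult.commute[of c])
qed

text \<open>The derivative bound is applied to \<open>\<phi> (w + d) - \<phi> w\<close>, which is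
  itself of size \<open>2 * M / R * norm d\<close>. Both the shift by \<open>d\<close> and the two
  nested balls of radius \<open>R\<close> have to fit, hence the radius
  \<open>3 * R\<close>.\<close>

lemma dir_deriv_lipschitz:
  assumes \<phi>: "line_holo \<phi> S" and "open S" and R: "R > 0" and sub: "cball z (3 * R) \<subseteq> S"
    and M: "\<And>w. w \<in> cball z (3 * R) \<Longrightarrow> cmod (\<phi> w) \<le> M" and d: "norm d \<le> R"
  shows "cmod (dir_deriv \<phi> v (z + d) - dir_deriv \<phi> v z) \<le> 4 * M / R\<^sup>2 * norm d * norm v"
proof -
  define T where "T = ball z (2 * R)"
  have T: "w + d \<in> S" "w \<in> S" if "w \<in> T" for w
    using that d sub norm_triangle_mono[of "z - w" "2 * R" "-d" R] R
    by (auto simp: T_def dist_norm algebra_simps intro!: subsetD[OF sub])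
  have l: "line_holo (\<lambda>w. \<phi> (w + d)) T" "line_holo \<phi> T"
    using line_holo_translate[OF \<phi> T(1)] line_holo_subset[OF \<phi>] T by auto
  define \<psi> where "\<psi> = (\<lambda>w. \<phi> (w + d) - \<phi> w)"
  have "line_holo \<psi> T"
    unfolding \<psi>_def by (rule line_holo_diff[OF l])
  moreover have "cmod (\<psi> w) \<le> 2 * M / R * norm d" if "w \<in> cball z R" for w
  proof -
    have "cball w R \<subseteq> cball z (3 * R)"
      using that R by (auto simp: cball_subset_cball_iff dist_commute)
    then show ?thesis
      unfolding \<psi>_def using sub M d by (intro cball_estimates(2)[OF \<phi> R]) auto
  qed
  ultimately have "cmod (dir_deriv \<psi> v z) \<le> 2 * (2 * M / R * norm d) / R * norm v"
    using R by (intro cball_estimates(1)[where S = T]) (auto simp: T_def cball_subset_ball_iff)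
  moreover have "dir_deriv \<psi> v z = dir_deriv \<phi> v (z + d) - dir_deriv \<phi> v z"
    unfolding \<psi>_def by (subst dir_deriv_diff[OF l]) (use R in \<open>auto simp: T_def dir_deriv_translate\<close>)
  ultimately show ?thesis
    by (simp add: power2_eq_square algebra_simps)
qed

lemma bounded_on_cball:
  fixes \<phi> :: "complex ^ 'n \<Rightarrow> complex"
  assumes "continuous_on S \<phi>" "cball z R \<subseteq> S"
  obtains M where "0 \<le> M" "\<And>w. w \<in> cball z R \<Longrightarrow> cmod (\<phi> w) \<le> M"
proof -
  have "bounded (\<phi> ` cball z R)"
    using compact_continuous_image[OF continuous_on_subset[OF assms] compact_cball]
      compact_imp_bounded by blast
  then obtain M where "\<And>w. w \<in> cball z R \<Longrightarrow> cmod (\<phi> w) \<le> M"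
    unfolding bounded_iff by blast
  then show ?thesis
    using that[of "max M 0"] by (meson max.cobounded2 max.coboundedI1)
qed

text \<open>The crux is additivity of the directional derivative. Moving from \<open>z\<close> by
  \<open>s *s (u + v)\<close> in one step or by \<open>s *s u\<close> and then \<open>s *s v\<close>
  reaches the same point, and all errors are quadratic in \<open>s\<close>. Hence the defect is at
  most linear in \<open>s\<close> after division, so it is zero. The Taylor estimate then gives the
  total derivative.\<close>

lemma line_holo_imp_holo:
  assumes \<phi>: "line_holo \<phi> S" and S: "open S"
  shows "holo \<phi> S"
  unfolding holo_def
proof (intro ballI exI conjI allI)
  fix z assume z: "z \<in> S"
  then obtain R0 where R0: "R0 > 0" "cball z R0 \<subseteq> S"
    using S open_contains_cball by blast
  define R where "R = R0 / 3"
  have R: "R > 0" and sub: "cball z (3 * R) \<subseteq> S"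
    using R0 by (simp_all add: R_def)
  obtain M where M0: "0 \<le> M" and M: "\<And>w. w \<in> cball z (3 * R) \<Longrightarrow> cmod (\<phi> w) \<le> M"
    using bounded_on_cball[OF _ sub, of \<phi>] \<phi> unfolding line_holo_def by blast
  show hom: "dir_deriv \<phi> (c *s v) z = c * dir_deriv \<phi> v z" for c v
    by (rule dir_deriv_smult[OF \<phi> S z])
  have est: "cmod (\<phi> (w + v) - \<phi> w - dir_deriv \<phi> v w) \<le> 4 * M / R\<^sup>2 * (norm v)\<^sup>2"
    if "w \<in> cball z R" "norm v \<le> R" for w v
  proof (rule cball_estimates(3)[OF \<phi> R _ _ that(2)])
    have "cball w R \<subseteq> cball z (3 * R)"
      using that R by (auto simp: cball_subset_cball_iff dist_commute)
    then show "cball w R \<subseteq> S" "\<And>y. y \<in> cball w R \<Longrightarrow> cmod (\<phi> y) \<le> M"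
      using sub M by auto
  qed
  have add: "dir_deriv \<phi> (u + v) z = dir_deriv \<phi> u z + dir_deriv \<phi> v z" for u v
  proof -
    define C where "C = 4 * M / R\<^sup>2"
    have C0: "C \<ge> 0" using M0 R by (simp add: C_def)
    define D where "D = cmod (dir_deriv \<phi> (u + v) z - dir_deriv \<phi> u z - dir_deriv \<phi> v z)"
    define K where "K = C * ((norm (u + v))\<^sup>2 + (norm u)\<^sup>2 + (norm v)\<^sup>2 + norm u * norm v)"
    \<comment> \<open>For \<open>t \<le> r\<close> the displacements along \<open>u\<close>,
      \<open>v\<close> and \<open>u + v\<close> all have norm at most \<open>R\<close>; the summand
      1 avoids division by zero.\<close>
    define r where "r = R / (norm u + norm v + 1)"
    have r: "r > 0" using R by (auto simp: r_def intro!: divide_pos_pos add_nonneg_pos)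
    have bnd: "D \<le> K * t" if t: "0 < t" "t \<le> r" for t
    proof -
      have "t * (norm u + norm v + 1) \<le> R"
        using t pos_le_divide_eq[of "norm u + norm v + 1" t R] by (simp add: r_def add_nonneg_pos)
      then have tR: "t * norm u + t * norm v + t \<le> R"
        by (simp add: algebra_simps)
      define s where "s = complex_of_real t"
      have ns: "norm (s *s y) = t * norm y" for y :: "complex ^ 'a"
        using t by (simp add: s_def norm_smult_complex)
      have nn: "0 \<le> t * norm u" "0 \<le> t * norm v" "t * norm (u + v) \<le> t * norm u + t * norm v"
        using t norm_triangle_ineq[of u v] by (simp_all flip: distrib_left)
      have u: "norm (s *s u) \<le> R" and v: "norm (s *s v) \<le> R" and uv: "norm (s *s (u + v)) \<le> R"
        unfolding ns using tR nn t by linarith+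
      have 1: "cmod (\<phi> (z + s *s (u + v)) - \<phi> z - dir_deriv \<phi> (s *s (u + v)) z)
          \<le> C * (norm (s *s (u + v)))\<^sup>2"
        unfolding C_def using R by (intro est uv) auto
      have 2: "cmod (\<phi> (z + s *s u) - \<phi> z - dir_deriv \<phi> (s *s u) z) \<le> C * (norm (s *s u))\<^sup>2"
        unfolding C_def using R by (intro est u) auto
      have 3: "cmod (\<phi> (z + s *s u + s *s v) - \<phi> (z + s *s u) - dir_deriv \<phi> (s *s v) (z + s *s u))
          \<le> C * (norm (s *s v))\<^sup>2"
        unfolding C_def using u by (intro est v) (simp add: dist_norm)
      have 4: "cmod (dir_deriv \<phi> (s *s v) (z + s *s u) - dir_deriv \<phi> (s *s v) z)
          \<le> C * norm (s *s u) * norm (s *s v)"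
        unfolding C_def by (rule dir_deriv_lipschitz[OF \<phi> S R sub M u])
      \<comment> \<open>The values of \<open>\<phi>\<close> telescope, and what remains are four
        errors, each already bounded by a multiple of \<open>t\<^sup>2\<close>.\<close>
      have eq: "s * (dir_deriv \<phi> (u + v) z - dir_deriv \<phi> u z - dir_deriv \<phi> v z) =
          - (\<phi> (z + s *s (u + v)) - \<phi> z - dir_deriv \<phi> (s *s (u + v)) z)
          + (\<phi> (z + s *s u) - \<phi> z - dir_deriv \<phi> (s *s u) z)
          + (\<phi> (z + s *s u + s *s v) - \<phi> (z + s *s u) - dir_deriv \<phi> (s *s v) (z + s *s u))
          + (dir_deriv \<phi> (s *s v) (z + s *s u) - dir_deriv \<phi> (s *s v) z)"
        unfolding hom by (simp add: algebra_simps vector_add_ldistrib)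
      have "t * D = cmod (s * (dir_deriv \<phi> (u + v) z - dir_deriv \<phi> u z - dir_deriv \<phi> v z))"
        using t by (simp add: norm_mult s_def D_def)
      also have "\<dots> \<le> C * (norm (s *s (u + v)))\<^sup>2 + C * (norm (s *s u))\<^sup>2 + C * (norm (s *s v))\<^sup>2
          + C * norm (s *s u) * norm (s *s v)"
        unfolding eq using 1
        by (intro norm_triangle_mono 2 3 4) (simp only: norm_minus_cancel)
      also have "\<dots> = t * (K * t)"
        unfolding ns K_def by (simp add: algebra_simps power2_eq_square)
      finally show ?thesis
        using t by simp
    qed
    have "D \<le> 0"
    proof (rule ccontr)
      assume "\<not> D \<le> 0"
      then have D: "D > 0" by simp
      have K0: "K \<ge> 0" using C0 by (simp add: K_def)
      define t where "t = min r (D / (2 * (K + 1)))"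
      have t: "0 < t" "t \<le> r" using r D K0 by (auto simp: t_def)
      have "K * t \<le> K * (D / (2 * (K + 1)))"
        using K0 by (intro mult_left_mono) (auto simp: t_def)
      also have "\<dots> < D"
        using D K0 by (auto simp: field_simps intro!: add_nonneg_pos)
      finally show False using bnd[OF t] by simp
    qed
    then show ?thesis by (simp add: D_def algebra_simps)
  qed
  show "(\<phi> has_derivative (\<lambda>v. dir_deriv \<phi> v z)) (at z)"
    unfolding has_derivative_at_alt
  proof (intro conjI allI impI)
    have "cball z R \<subseteq> cball z (3 * R)"
      using R by (simp add: cball_subset_cball_iff)
    then have "cmod (dir_deriv \<phi> v z) \<le> norm v * (2 * M / R)" for v
      using cball_estimates(1)[OF \<phi> R, of z M v] sub M by (metis mult.commute subset_iff)
    then show "bounded_linear (\<lambda>v. dir_deriv \<phi> v z)"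
      using add hom by (intro bounded_linear_intro[where K = "2 * M / R"]) (auto simp: scaleR_eq_smult scaleR_conv_of_real)
    fix e :: real assume e: "e > 0"
    define C where "C = 4 * M / R\<^sup>2 + 1"
    have C: "C > 0" using M0 R by (simp add: C_def add_nonneg_pos)
    show "\<exists>d>0. \<forall>y. norm (y - z) < d \<longrightarrow> norm (\<phi> y - \<phi> z - dir_deriv \<phi> (y - z) z) \<le> e * norm (y - z)"
    proof (intro exI conjI allI impI)
      show "0 < min R (e / C)" using R e C by simp
      fix y assume y: "norm (y - z) < min R (e / C)"
      have "norm (\<phi> y - \<phi> z - dir_deriv \<phi> (y - z) z) \<le> 4 * M / R\<^sup>2 * (norm (y - z))\<^sup>2"
        using est[of z "y - z"] y R by simp
      also have "\<dots> \<le> (C * norm (y - z)) * norm (y - z)"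
        by (simp add: C_def power2_eq_square algebra_simps)
      also have "\<dots> \<le> e * norm (y - z)"
        using y C by (intro mult_right_mono) (auto simp: field_simps)
      finally show "norm (\<phi> y - \<phi> z - dir_deriv \<phi> (y - z) z) \<le> e * norm (y - z)" .
    qed
  qed
qed

lemma holo_iff_line_holo: "open S \<Longrightarrow> holo \<phi> S \<longleftrightarrow> line_holo \<phi> S"
  using holo_imp_line_holo line_holo_imp_holo by blast

section \<open>Sums, products and determinants of holomorphic functions\<close>

lemma line_holo_const: "line_holo (\<lambda>_. c) S"
  by (simp add: line_holo_def)

lemma line_holo_mult: "line_holo \<phi> S \<Longrightarrow> line_holo \<psi> S \<Longrightarrow> line_holo (\<lambda>z. \<phi> z * \<psi> z) S"
  unfolding line_holo_def by (auto intro!: continuous_intros holomorphic_intros)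

lemma line_holo_add: "line_holo \<phi> S \<Longrightarrow> line_holo \<psi> S \<Longrightarrow> line_holo (\<lambda>z. \<phi> z + \<psi> z) S"
  unfolding line_holo_def by (auto intro!: continuous_intros holomorphic_intros)

lemma line_holo_sum:
  "finite I \<Longrightarrow> (\<And>i. i \<in> I \<Longrightarrow> line_holo (\<phi> i) S) \<Longrightarrow> line_holo (\<lambda>z. \<Sum>i\<in>I. \<phi> i z) S"
  by (induction I rule: finite_induct) (auto intro: line_holo_const line_holo_add)

lemma line_holo_prod:
  "finite I \<Longrightarrow> (\<And>i. i \<in> I \<Longrightarrow> line_holo (\<phi> i) S) \<Longrightarrow> line_holo (\<lambda>z. \<Prod>i\<in>I. \<phi> i z) S"
  by (induction I rule: finite_induct) (auto intro: line_holo_const line_holo_mult)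

lemma line_holo_det:
  fixes A :: "complex ^ 'n \<Rightarrow> complex ^ 'm ^ 'm"
  assumes "\<And>i j. line_holo (\<lambda>z. A z $ i $ j) S"
  shows "line_holo (\<lambda>z. det (A z)) S"
  unfolding det_def
  by (intro line_holo_sum line_holo_mult line_holo_const line_holo_prod assms)
    (simp_all add: finite_permutations)

section \<open>Locally uniform limits\<close>

definition loc_unif ::
    "(nat \<Rightarrow> 'a::metric_space \<Rightarrow> 'b::metric_space) \<Rightarrow> ('a \<Rightarrow> 'b) \<Rightarrow> 'a set \<Rightarrow> bool" where
  "loc_unif F f S \<longleftrightarrow> (\<forall>K. compact K \<and> K \<subseteq> S \<longrightarrow> uniform_limit K F f sequentially)"

lemma loc_unifD: "loc_unif F f S \<Longrightarrow> compact K \<Longrightarrow> K \<subseteq> S \<Longrightarrow> uniform_limit K F f sequentially"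
  unfolding loc_unif_def by blast

lemma loc_unif_subseq:
  assumes "loc_unif F f S" "strict_mono r"
  shows "loc_unif (\<lambda>n. F (r n)) f S"
  unfolding loc_unif_def
proof (intro allI impI)
  fix K assume "compact K \<and> K \<subseteq> S"
  then have "uniform_limit K F f sequentially"
    using loc_unifD[OF assms(1)] by blast
  from filterlim_compose[OF this filterlim_subseq[OF assms(2)]]
  show "uniform_limit K (\<lambda>n. F (r n)) f sequentially" .
qed

lemma loc_unif_tendsto: "loc_unif F f S \<Longrightarrow> z \<in> S \<Longrightarrow> (\<lambda>n. F n z) \<longlonglongrightarrow> f z"
  by (rule tendsto_uniform_limitI[OF loc_unifD[where K = "{z}"]]) auto

lemma loc_unif_component:
  fixes F :: "nat \<Rightarrow> 'a::metric_space \<Rightarrow> complex ^ 'm"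
  shows "loc_unif F f S \<Longrightarrow> loc_unif (\<lambda>n z. F n z $ i) (\<lambda>z. f z $ i) S"
  unfolding loc_unif_def by (simp add: bounded_linear.uniform_limit[OF bounded_linear_vec_nth])

lemma loc_unif_continuous_on:
  fixes f :: "'a::heine_borel \<Rightarrow> 'b::metric_space"
  assumes "loc_unif F f S" "open S" "\<And>n. continuous_on S (F n)"
  shows "continuous_on S f"
proof (rule continuous_at_imp_continuous_on, rule ballI)
  fix z assume "z \<in> S"
  then obtain R where R: "R > 0" "cball z R \<subseteq> S"
    using assms(2) open_contains_cball by blast
  have "uniform_limit (cball z R) F f sequentially"
    using loc_unifD[OF assms(1) compact_cball R(2)] .
  then have "continuous_on (cball z R) f"
    by (rule uniform_limit_theorem[rotated])
      (auto intro!: always_eventually continuous_on_subset[OF assms(3) R(2)])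
  then have "continuous_on (ball z R) f"
    by (rule continuous_on_subset) auto
  then show "isCont f z"
    using R by (simp add: continuous_on_eq_continuous_at)
qed

text \<open>Weierstrass's theorem in one variable on each complex line: a closed disc of parameters
  has a compact image, so convergence on it is uniform.\<close>

lemma loc_unif_line_holo:
  assumes lim: "loc_unif F f S" and S: "open S" and F: "\<And>n. line_holo (F n) S"
  shows "line_holo f S"
  unfolding line_holo_def
proof (intro conjI allI)
  show "continuous_on S f"
    using loc_unif_continuous_on[OF lim S] F by (simp add: line_holo_def)
  fix a v
  let ?T = "{t. a + t *s v \<in> S}"
  have T: "open ?T"
    by (rule open_complex_line[OF S])
  show "(\<lambda>t. f (a + t *s v)) holomorphic_on ?T"
  proof (rule holomorphic_uniform_sequence[OF T, where f = "\<lambda>n t. F n (a + t *s v)"])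
    show "(\<lambda>t. F n (a + t *s v)) holomorphic_on ?T" for n
      using F by (simp add: line_holo_def)
    fix t assume "t \<in> ?T"
    then obtain d where d: "d > 0" "cball t d \<subseteq> ?T"
      using T open_contains_cball by blast
    let ?K = "(\<lambda>t. a + t *s v) ` cball t d"
    have "uniform_limit ?K F f sequentially"
      using d by (intro loc_unifD[OF lim] compact_continuous_image continuous_on_complex_line) auto
    then have "uniform_limit (cball t d) (\<lambda>n t. F n (a + t *s v)) (\<lambda>t. f (a + t *s v)) sequentially"
      unfolding uniform_limit_iff by auto
    then show "\<exists>d>0. cball t d \<subseteq> ?T \<and>
        uniform_limit (cball t d) (\<lambda>n t. F n (a + t *s v)) (\<lambda>t. f (a + t *s v)) sequentially"
      using d by blast
  qed
qed

lemma loc_unif_holomorphic_map_on: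
  assumes "loc_unif F f S" "open S" "\<And>n. holomorphic_map_on (F n) S"
  shows "holomorphic_map_on f S"
  unfolding holomorphic_map_on_iff_holo
proof
  fix i
  show "holo (\<lambda>z. f z $ i) S"
    using loc_unif_line_holo[OF loc_unif_component[OF assms(1)] assms(2), of i] assms(2,3)
    by (simp add: holomorphic_map_on_iff_holo holo_iff_line_holo)
qed

text \<open>Near each point the directional derivative is a uniform limit of difference quotients,
  because the remainder estimate holds with one bound \<open>M\<close> at all nearby points. The
  quotients are holomorphic, hence so is the limit.\<close>

lemma holo_dir_deriv:
  assumes "holo \<phi> S" and S: "open S"
  shows "holo (dir_deriv \<phi> v) S"
proof -
  have \<phi>: "line_holo \<phi> S"
    using assms holo_imp_line_holo by blast
  have "\<exists>T. open T \<and> z \<in> T \<and> holo (dir_deriv \<phi> v) T" if "z \<in> S" for z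
  proof -
    obtain R0 where R0: "R0 > 0" "cball z R0 \<subseteq> S"
      using S \<open>z \<in> S\<close> open_contains_cball by blast
    define R where "R = R0 / 2"
    have R: "R > 0" and sub: "cball z (2 * R) \<subseteq> S"
      using R0 by (simp_all add: R_def)
    obtain M where M0: "0 \<le> M" and M: "\<And>w. w \<in> cball z (2 * R) \<Longrightarrow> cmod (\<phi> w) \<le> M"
      using bounded_on_cball[OF _ sub, of \<phi>] \<phi> unfolding line_holo_def by blast
    define T where "T = ball z R"
    \<comment> \<open>\<open>N\<close> starts the sequence late enough that every step
      \<open>d n\<close> has norm at most \<open>R\<close>; the summand 1 keeps \<open>N + n\<close>
      positive when \<open>v = 0\<close>.\<close>
    define N where "N = nat \<lceil>norm v / R\<rceil> + 1"
    define d where "d = (\<lambda>n. complex_of_real (1 / real (N + n)) *s v)"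
    have N: "real (N + n) > 0" for n
      by (simp add: N_def)
    have nd: "norm (d n) = norm v / real (N + n)" for n
      unfolding d_def norm_smult_complex norm_of_real by simp
    have dR: "norm (d n) \<le> R" for n
    proof -
      have "norm v / R \<le> real (N + n)"
        unfolding N_def by linarith
      then show ?thesis
        unfolding nd using R N[of n] by (simp add: field_simps)
    qed
    have sub': "cball w R \<subseteq> cball z (2 * R)" if "w \<in> T" for w
      using that R by (auto simp: T_def cball_subset_cball_iff dist_commute)
    define f where "f = (\<lambda>n w. of_nat (N + n) * (\<phi> (w + d n) - \<phi> w))"
    have err: "cmod (f n w - dir_deriv \<phi> v w) \<le> 4 * M / R\<^sup>2 * (norm v)\<^sup>2 / real (N + n)" if w: "w \<in> T" for n w
    proof -
      have wS: "w \<in> S" "cball w R \<subseteq> S"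
        using sub'[OF w] sub R centre_in_cball[of w R] by (blast dest: less_imp_le)+
      have "cmod (\<phi> (w + d n) - \<phi> w - dir_deriv \<phi> (d n) w) \<le> 4 * M / R\<^sup>2 * (norm (d n))\<^sup>2"
        using sub'[OF w] by (intro cball_estimates(3)[OF \<phi> R wS(2) M dR]) auto
      also have "dir_deriv \<phi> (d n) w = dir_deriv \<phi> v w / of_nat (N + n)"
        unfolding d_def by (subst dir_deriv_smult[OF \<phi> S wS(1)]) simp
      also have "\<phi> (w + d n) - \<phi> w - dir_deriv \<phi> v w / of_nat (N + n) = (f n w - dir_deriv \<phi> v w) / of_nat (N + n)"
        using N[of n] by (simp add: f_def field_simps del: of_nat_add)
      finally have "cmod (f n w - dir_deriv \<phi> v w) / real (N + n) \<le>
          (4 * M / R\<^sup>2 * (norm v)\<^sup>2 / real (N + n)) / real (N + n)"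
        by (simp add: norm_divide nd power_divide power2_eq_square mult.assoc del: of_nat_add)
      then show ?thesis
        using N[of n] by (simp only: divide_le_cancel)
    qed
    have f: "line_holo (f n) T" for n
      unfolding f_def
    proof (intro line_holo_mult line_holo_const line_holo_diff line_holo_translate[OF \<phi>]
        line_holo_subset[OF \<phi>])
      show "T \<subseteq> S"
        using sub R by (auto simp: T_def)
      fix w assume w: "w \<in> T"
      then have "w + d n \<in> cball w R"
        using dR[of n] by (simp add: dist_norm)
      then show "w + d n \<in> S"
        using sub'[OF w] sub by blast
    qed
    have "uniform_limit T f (dir_deriv \<phi> v) sequentially"
    proof (rule uniform_limitI)
      fix e :: real assume e: "e > 0"
      define C where "C = 4 * M / R\<^sup>2 * (norm v)\<^sup>2"
      have "(\<lambda>n. C / real (N + n)) \<longlonglongrightarrow> 0"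
        using LIMSEQ_ignore_initial_segment[OF lim_const_over_n[of C], of N] by (simp add: add.commute)
      then have "\<forall>\<^sub>F n in sequentially. C / real (N + n) < e"
        using e order_tendstoD(2) by blast
      then show "\<forall>\<^sub>F n in sequentially. \<forall>w\<in>T. dist (f n w) (dir_deriv \<phi> v w) < e"
        by (rule eventually_mono)
          (use err in \<open>auto simp: dist_norm C_def intro: le_less_trans\<close>)
    qed
    then have "loc_unif f (dir_deriv \<phi> v) T"
      unfolding loc_unif_def using uniform_limit_on_subset by blast
    then have "holo (dir_deriv \<phi> v) T"
      by (intro line_holo_imp_holo loc_unif_line_holo[OF _ _ f]) (simp_all add: T_def)
    then show ?thesis
      using R by (intro exI[of _ T]) (simp add: T_def)
  qed
  then show ?thesis
    unfolding holo_def by meson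
qed

text \<open>The derivative bound of \<open>cball_estimates\<close> is applied to
  \<open>F n - f\<close> on balls of one common radius about the points of the compact set.\<close>

lemma loc_unif_dir_deriv:
  assumes lim: "loc_unif F f S" and S: "open S" and F: "\<And>n. line_holo (F n) S"
  shows "loc_unif (\<lambda>n. dir_deriv (F n) v) (dir_deriv f v) S"
  unfolding loc_unif_def
proof (intro allI impI)
  fix K assume K: "compact K \<and> K \<subseteq> S"
  then obtain R where R: "R > 0" and sub: "(\<Union>x\<in>K. cball x R) \<subseteq> S"
    using compact_subset_open_imp_cball_epsilon_subset[OF _ S] by blast
  have f: "line_holo f S"
    by (rule loc_unif_line_holo[OF lim S F])
  have u: "uniform_limit (\<Union>x\<in>K. cball x R) F f sequentially"
    using K sub by (intro loc_unifD[OF lim] compact_minkowski_sum_cball) auto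
  show "uniform_limit K (\<lambda>n. dir_deriv (F n) v) (dir_deriv f v) sequentially"
  proof (rule uniform_limitI)
    fix e :: real assume e: "e > 0"
    \<comment> \<open>The summand 1 admits \<open>v = 0\<close> and makes the final estimate
      strict.\<close>
    define c where "c = norm v + 1"
    have c: "c > 0"
      by (simp add: c_def add_nonneg_pos)
    define d where "d = e * R / c / 2"
    have d: "d > 0"
      using e R c by (simp add: d_def)
    have "\<forall>\<^sub>F n in sequentially. \<forall>x\<in>(\<Union>x\<in>K. cball x R). dist (F n x) (f x) < d"
      by (rule uniform_limitD[OF u d])
    then show "\<forall>\<^sub>F n in sequentially. \<forall>x\<in>K. dist (dir_deriv (F n) v x) (dir_deriv f v x) < e"
    proof (rule eventually_mono, intro ballI)
      fix n x assume n: "\<forall>x\<in>(\<Union>x\<in>K. cball x R). dist (F n x) (f x) < d" and x: "x \<in> K"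
      have xS: "x \<in> S" "cball x R \<subseteq> S" using x K sub by auto
      have "cmod (dir_deriv (\<lambda>z. F n z - f z) v x) \<le> 2 * d / R * norm v"
      proof (rule cball_estimates(1)[OF line_holo_diff[OF F f] R xS(2)])
        fix w assume "w \<in> cball x R"
        then show "cmod (F n w - f w) \<le> d"
          using n x by (force simp: dist_norm)
      qed
      also have "2 * d / R * norm v = e * (norm v / c)"
        using R by (simp add: d_def)
      also have "\<dots> < e * 1"
        using e c by (intro mult_strict_left_mono) (auto simp: divide_less_eq c_def)
      finally show "dist (dir_deriv (F n) v x) (dir_deriv f v x) < e"
        by (simp add: dir_deriv_diff[OF F f S xS(1)] dist_norm)
    qed
  qed
qed

text \<open>Boundedness of the limit is carried through the induction because multiplying uniform
  limits requires it.\<close>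

lemma uniform_limit_prod_bounded:
  fixes f :: "'i \<Rightarrow> nat \<Rightarrow> 'a \<Rightarrow> complex"
  assumes "finite I" "\<And>i. i \<in> I \<Longrightarrow> uniform_limit K (f i) (l i) F \<and> bounded (l i ` K)"
  shows "uniform_limit K (\<lambda>n x. \<Prod>i\<in>I. f i n x) (\<lambda>x. \<Prod>i\<in>I. l i x) F \<and>
    bounded ((\<lambda>x. \<Prod>i\<in>I. l i x) ` K)"
  using assms
proof (induction I rule: finite_induct)
  case empty
  then show ?case
    by (simp add: uniform_limit_const finite_imp_bounded image_constant_conv)
next
  case (insert i I)
  then have IH: "uniform_limit K (\<lambda>n x. \<Prod>i\<in>I. f i n x) (\<lambda>x. \<Prod>i\<in>I. l i x) F"
      "bounded ((\<lambda>x. \<Prod>i\<in>I. l i x) ` K)" and i: "uniform_limit K (f i) (l i) F" "bounded (l i ` K)"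
    by auto
  obtain a b where "\<And>x. x \<in> K \<Longrightarrow> cmod (l i x) \<le> a" "\<And>x. x \<in> K \<Longrightarrow> cmod (\<Prod>i\<in>I. l i x) \<le> b"
    using i(2) IH(2) unfolding bounded_iff by auto
  then have "bounded ((\<lambda>x. l i x * (\<Prod>i\<in>I. l i x)) ` K)"
    unfolding bounded_iff norm_mult ball_simps
    by (intro exI[of _ "a * b"] ballI)
      (auto simp: norm_mult intro!: mult_mono order_trans[OF norm_ge_zero])
  moreover have "uniform_limit K (\<lambda>n x. f i n x * (\<Prod>i\<in>I. f i n x))
      (\<lambda>x. l i x * (\<Prod>i\<in>I. l i x)) F"
    by (rule uniform_lim_mult[OF i(1) IH(1) i(2) IH(2)])
  ultimately show ?case
    using insert by simp
qed

lemma uniform_limit_sum_complex: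
  fixes f :: "'i \<Rightarrow> nat \<Rightarrow> 'a \<Rightarrow> complex"
  assumes "finite I" "\<And>i. i \<in> I \<Longrightarrow> uniform_limit K (f i) (l i) F"
  shows "uniform_limit K (\<lambda>n x. \<Sum>i\<in>I. f i n x) (\<lambda>x. \<Sum>i\<in>I. l i x) F"
  using assms
  by (induction I rule: finite_induct) (auto intro: uniform_limit_const uniform_limit_add)

lemma loc_unif_det:
  fixes F :: "nat \<Rightarrow> 'a::metric_space \<Rightarrow> complex ^ 'm ^ 'm"
  assumes lim: "\<And>i j. loc_unif (\<lambda>n z. F n z $ i $ j) (\<lambda>z. f z $ i $ j) S"
    and cont: "\<And>i j. continuous_on S (\<lambda>z. f z $ i $ j)"
  shows "loc_unif (\<lambda>n z. det (F n z)) (\<lambda>z. det (f z)) S"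
  unfolding loc_unif_def
proof (intro allI impI)
  fix K assume K: "compact K \<and> K \<subseteq> S"
  have b: "bounded ((\<lambda>z. f z $ i $ j) ` K)" for i j
    using K cont by (intro compact_imp_bounded compact_continuous_image) (auto intro: continuous_on_subset)
  have u: "uniform_limit K (\<lambda>n z. F n z $ i $ j) (\<lambda>z. f z $ i $ j) sequentially" for i j
    using loc_unifD[OF lim] K by blast
  show "uniform_limit K (\<lambda>n z. det (F n z)) (\<lambda>z. det (f z)) sequentially"
    unfolding det_def
    by (intro uniform_limit_sum_complex bounded_linear.uniform_limit[OF bounded_linear_mult_right]
        conjunct1[OF uniform_limit_prod_bounded])
      (use u b in \<open>auto simp: finite_permutations\<close>)
qed

lemma jac_component: "jac f z $ i $ j = dir_deriv (\<lambda>z. f z $ i) (axis j 1) z"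
  by (simp add: jac_def)

lemma holo_jac:
  assumes "holomorphic_map_on f S" "open S"
  shows "holo (\<lambda>z. jac f z $ i $ j) S"
  unfolding jac_component using assms
  by (intro holo_dir_deriv[of "\<lambda>z. f z $ i", unfolded eta_contract_eq]) (auto simp: holomorphic_map_on_iff_holo)

lemma holo_det_jac:
  assumes "holomorphic_map_on f S" "open S"
  shows "holo (\<lambda>z. det (jac f z)) S"
  using assms holo_jac[OF assms] by (simp add: holo_iff_line_holo line_holo_det)

lemma loc_unif_det_jac:
  assumes lim: "loc_unif F f S" and S: "open S" and F: "\<And>n. holomorphic_map_on (F n) S"
  shows "loc_unif (\<lambda>n z. det (jac (F n) z)) (\<lambda>z. det (jac f z)) S"
proof (rule loc_unif_det)
  fix i j
  show "loc_unif (\<lambda>n z. jac (F n) z $ i $ j) (\<lambda>z. jac f z $ i $ j) S"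
    unfolding jac_component
    using F by (intro loc_unif_dir_deriv[OF loc_unif_component[OF lim] S])
      (auto simp: holomorphic_map_on_iff_holo intro: holo_imp_line_holo)
  show "continuous_on S (\<lambda>z. jac f z $ i $ j)"
    using holo_jac[OF loc_unif_holomorphic_map_on[OF lim S F] S] holo_continuous_on by blast
qed

section \<open>Lipschitz bounds and Montel's theorem for maps\<close>

lemma norm_vec_le_card:
  fixes x :: "complex ^ 'm"
  assumes "\<And>i. norm (x $ i) \<le> b"
  shows "norm x \<le> real CARD('m) * b"
proof -
  have "norm x \<le> (\<Sum>i\<in>UNIV. norm (x $ i))"
    unfolding norm_vec_def by (rule L2_set_le_sum) simp
  also have "\<dots> \<le> real CARD('m) * b"
    using sum_bounded_above[of UNIV "\<lambda>i. norm (x $ i)" b] assms by simp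
  finally show ?thesis .
qed

lemma holomorphic_map_on_lipschitz:
  fixes f :: "complex ^ 'n \<Rightarrow> complex ^ 'm"
  assumes f: "holomorphic_map_on f S" and R: "R > 0" and sub: "cball z R \<subseteq> S"
    and B: "\<And>w. w \<in> cball z R \<Longrightarrow> norm (f w) \<le> B" and v: "norm v \<le> R"
  shows "norm (f (z + v) - f z) \<le> real CARD('m) * (2 * B / R * norm v)"
proof (rule norm_vec_le_card)
  fix i
  have "cmod (f (z + v) $ i - f z $ i) \<le> 2 * B / R * norm v"
  proof (rule cball_estimates(2)[OF holo_imp_line_holo R sub _ v])
    show "holo (\<lambda>z. f z $ i) S"
      using f by (simp add: holomorphic_map_on_iff_holo)
    show "cmod (f w $ i) \<le> B" if "w \<in> cball z R" for w
      by (rule order_trans[OF Finite_Cartesian_Product.norm_nth_le B[OF that]])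
  qed
  then show "cmod ((f (z + v) - f z) $ i) \<le> 2 * B / R * norm v"
    by simp
qed

text \<open>The common bound \<open>B\<close> gives a local Lipschitz constant independent of
  \<open>n\<close>, hence equicontinuity. Arzela-Ascoli on each member of a compact exhaustion and a
  diagonal sequence finish the argument.\<close>

lemma montel_maps:
  fixes F :: "nat \<Rightarrow> complex ^ 'n \<Rightarrow> complex ^ 'm"
  assumes S: "open S" and F: "\<And>n. holomorphic_map_on (F n) S"
    and B: "\<And>n z. z \<in> S \<Longrightarrow> norm (F n z) \<le> B"
  obtains r g where "strict_mono (r :: nat \<Rightarrow> nat)" "loc_unif (\<lambda>n. F (r n)) g S"
proof -
  obtain C where C: "\<And>n :: nat. compact (C n)" "\<And>n. C n \<subseteq> S"
    and C_cover: "\<And>K. \<lbrakk>compact K; K \<subseteq> S\<rbrakk> \<Longrightarrow> \<exists>N. \<forall>n\<ge>N. K \<subseteq> C n"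
    using open_Union_compact_subsets[OF S] by metis
  define P where "P = (\<lambda>i (r :: nat \<Rightarrow> nat). \<exists>g. uniform_limit (C i) (\<lambda>n. F (r n)) g sequentially)"
  have sub: "\<exists>k. strict_mono (k :: nat \<Rightarrow> nat) \<and> P i (r \<circ> k)" for i and r :: "nat \<Rightarrow> nat"
  proof -
    obtain g k where k: "strict_mono (k :: nat \<Rightarrow> nat)"
      and g: "\<And>e. 0 < e \<Longrightarrow> \<exists>N. \<forall>n x. n \<ge> N \<and> x \<in> C i \<longrightarrow> norm (F (r (k n)) x - g x) < e"
    proof (rule Arzela_Ascoli[of "C i" "\<lambda>n. F (r n)" B])
      show "compact (C i)" by (rule C)
      show "norm (F (r n) x) \<le> B" if "x \<in> C i" for n x
        using B C(2) that by blast
      fix x and e :: real assume x: "x \<in> C i" and e: "0 < e"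
      then obtain R where R: "R > 0" "cball x R \<subseteq> S"
        using S C(2)[of i] open_contains_cball by blast
      have B0: "0 \<le> B"
        using order_trans[OF norm_ge_zero B] x C(2) by blast
      define L where "L = real CARD('m) * (2 * B / R) + 1"
      have L: "L > 0" using B0 R by (simp add: L_def add_nonneg_pos)
      show "\<exists>d>0. \<forall>n y. y \<in> C i \<and> norm (x - y) < d \<longrightarrow> norm (F (r n) x - F (r n) y) < e"
      proof (intro exI conjI allI impI)
        show "0 < min R (e / L)" using R e L by simp
        fix n y assume y: "y \<in> C i \<and> norm (x - y) < min R (e / L)"
        have "norm (F (r n) (x + (y - x)) - F (r n) x) \<le> real CARD('m) * (2 * B / R * norm (y - x))"
          using R B y by (intro holomorphic_map_on_lipschitz[OF F]) (auto simp: norm_minus_commute)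
        also have "\<dots> \<le> L * norm (y - x)"
          by (simp add: L_def algebra_simps)
        also have "\<dots> < e"
          using y L by (auto simp: norm_minus_commute field_simps)
        finally show "norm (F (r n) x - F (r n) y) < e"
          by (simp add: norm_minus_commute)
      qed
    qed (use that in blast)
    have "uniform_limit (C i) (\<lambda>n. F ((r \<circ> k) n)) g sequentially"
      unfolding uniform_limit_sequentially_iff dist_norm o_def using g by blast
    then show ?thesis
      using k unfolding P_def by blast
  qed
  obtain k where k: "strict_mono (k :: nat \<Rightarrow> nat)" and Pk: "\<And>i. P i (id \<circ> k)"
  proof (rule subsequence_diagonalization_lemma[of P id])
    show "\<exists>k. strict_mono (k :: nat \<Rightarrow> nat) \<and> P i (r \<circ> k)" for i r
      by (rule sub)
    \<comment> \<open>Uniform convergence survives when the late terms of the new sequence are drawn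
      from equally late terms of the old one, as happens for the diagonal sequence.\<close>
    fix i and r k1 k2 :: "nat \<Rightarrow> nat" and N
    assume "P i (r \<circ> k1)" and k2: "\<And>j. N \<le> j \<Longrightarrow> \<exists>j'. j \<le> j' \<and> k2 j = k1 j'"
    then obtain g where g: "uniform_limit (C i) (\<lambda>n. F ((r \<circ> k1) n)) g sequentially"
      unfolding P_def by blast
    have "uniform_limit (C i) (\<lambda>n. F ((r \<circ> k2) n)) g sequentially"
      unfolding uniform_limit_sequentially_iff
    proof (intro allI impI)
      fix e :: real assume "e > 0"
      then obtain N' where N': "\<forall>n\<ge>N'. \<forall>x\<in>C i. dist (F ((r \<circ> k1) n) x) (g x) < e"
        using g unfolding uniform_limit_sequentially_iff by blast
      show "\<exists>N. \<forall>n\<ge>N. \<forall>x\<in>C i. dist (F ((r \<circ> k2) n) x) (g x) < e"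
      proof (intro exI allI impI ballI)
        fix n x assume n: "max N N' \<le> n" and x: "x \<in> C i"
        then obtain j' where "n \<le> j'" "k2 n = k1 j'"
          using k2[of n] by auto
        then show "dist (F ((r \<circ> k2) n) x) (g x) < e"
          using N' n x by simp
      qed
    qed
    then show "P i (r \<circ> k2)"
      unfolding P_def by blast
  qed (use that in blast)
  \<comment> \<open>The limits obtained on the separate sets \<open>C i\<close> agree with the
    pointwise limit, which therefore glues them.\<close>
  define g where "g = (\<lambda>z. lim (\<lambda>n. F (k n) z))"
  have "loc_unif (\<lambda>n. F (k n)) g S"
    unfolding loc_unif_def
  proof (intro allI impI)
    fix K assume "compact K \<and> K \<subseteq> S"
    then obtain i where i: "K \<subseteq> C i"
      using C_cover[of K] by (meson order_refl)
    obtain g' where g': "uniform_limit (C i) (\<lambda>n. F (k n)) g' sequentially"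
      using Pk[of i] unfolding P_def id_o by blast
    have eq: "g' z = g z" if "z \<in> K" for z
      unfolding g_def using tendsto_uniform_limitI[OF g', of z] that i by (auto intro!: limI[symmetric])
    show "uniform_limit K (\<lambda>n. F (k n)) g sequentially"
      by (rule iffD1[OF uniform_limit_cong'[OF refl eq] uniform_limit_on_subset[OF g' i]])
  qed
  with k show ?thesis
    using that by blast
qed

section \<open>Injective holomorphic maps\<close>

lemma det_eq_0_iff_kernel:
  fixes A :: "complex ^ 'n ^ 'n"
  shows "det A = 0 \<longleftrightarrow> (\<exists>v. v \<noteq> 0 \<and> A *v v = 0)"
  using invertible_det_nz[of A] invertible_left_inverse[of A] matrix_left_invertible_ker[of A]
  by blast

text \<open>Supplies the continuity of the derivative in operator norm that the local injectivity
  theorem asks for.\<close>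

lemma jac_lipschitz:
  fixes f :: "complex ^ 'n \<Rightarrow> complex ^ 'm"
  assumes f: "holomorphic_map_on f S" and S: "open S" and a: "a \<in> S"
  obtains R C where "R > 0" "C \<ge> 0"
    "\<And>x v. dist a x \<le> R \<Longrightarrow> norm (jac f x *v v - jac f a *v v) \<le> C * dist a x * norm v"
proof -
  obtain R0 where R0: "R0 > 0" "cball a R0 \<subseteq> S"
    using S a open_contains_cball by blast
  define R where "R = R0 / 3"
  have R: "R > 0" and sub: "cball a (3 * R) \<subseteq> S"
    using R0 by (simp_all add: R_def)
  have "compact (f ` cball a (3 * R))"
    using holomorphic_map_on_continuous_on[OF f] continuous_on_subset[OF _ sub]
    by (intro compact_continuous_image) auto
  then have "bounded (f ` cball a (3 * R))"
    by (rule compact_imp_bounded)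
  then obtain M where M: "\<And>w. w \<in> cball a (3 * R) \<Longrightarrow> norm (f w) \<le> M"
    unfolding bounded_iff by blast
  have M0: "0 \<le> M"
    using order_trans[OF norm_ge_zero M[of a]] R by simp
  define C where "C = real CARD('m) * (4 * M / R\<^sup>2)"
  show thesis
  proof (rule that[of R C])
    show "R > 0" "C \<ge> 0" using R M0 by (simp_all add: C_def)
    fix x v assume x: "dist a x \<le> R"
    have xS: "x \<in> S" using x sub R by auto
    have holo: "holo (\<lambda>z. f z $ i) S" for i
      using f by (simp add: holomorphic_map_on_iff_holo)
    have "norm (jac f x *v v - jac f a *v v) \<le> real CARD('m) * (4 * M / R\<^sup>2 * norm (x - a) * norm v)"
    proof (rule norm_vec_le_card)
      fix i
      have "cmod (dir_deriv (\<lambda>z. f z $ i) v (a + (x - a)) - dir_deriv (\<lambda>z. f z $ i) v a)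
          \<le> 4 * M / R\<^sup>2 * norm (x - a) * norm v"
      proof (rule dir_deriv_lipschitz[OF holo_imp_line_holo[OF holo] S R sub])
        show "cmod (f w $ i) \<le> M" if "w \<in> cball a (3 * R)" for w
          by (rule order_trans[OF Finite_Cartesian_Product.norm_nth_le M[OF that]])
        show "norm (x - a) \<le> R" using x by (simp add: dist_norm norm_minus_commute)
      qed
      then show "cmod ((jac f x *v v - jac f a *v v) $ i) \<le> 4 * M / R\<^sup>2 * norm (x - a) * norm v"
        by (simp add: jac_mult_component[OF holo xS] jac_mult_component[OF holo a])
    qed
    then show "norm (jac f x *v v - jac f a *v v) \<le> C * dist a x * norm v"
      by (simp add: C_def dist_norm norm_minus_commute algebra_simps)
  qed
qed

lemma holomorphic_map_on_locally_injective:
  fixes f :: "complex ^ 'n \<Rightarrow> complex ^ 'n"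
  assumes f: "holomorphic_map_on f S" and S: "open S" and a: "a \<in> S" and det: "det (jac f a) \<noteq> 0"
  obtains r where "r > 0" "ball a r \<subseteq> S" "inj_on f (ball a r)"
proof -
  obtain B where B: "B ** jac f a = mat 1"
    using det invertible_det_nz[of "jac f a"] invertible_left_inverse[of "jac f a"] by blast
  obtain R C where R: "R > 0" and C: "C \<ge> 0" and
    lip: "\<And>x v. dist a x \<le> R \<Longrightarrow> norm (jac f x *v v - jac f a *v v) \<le> C * dist a x * norm v"
    using jac_lipschitz[OF f S a] by blast
  show thesis
  proof (rule has_derivative_locally_injective[of a S "(*v) B" "\<lambda>x. (*v) (jac f x)" f])
    show "a \<in> S" "open S" by fact+
    show "bounded_linear ((*v) B)" by simp
    show "(*v) B \<circ> (*v) (jac f a) = id"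
      using B by (simp add: fun_eq_iff matrix_vector_mul_assoc)
    show "(f has_derivative (*v) (jac f x)) (at x)" if "x \<in> S" for x
      by (rule holomorphic_map_on_has_derivative[OF f that])
    fix e :: real assume e: "e > 0"
    show "\<exists>d>0. \<forall>x. dist a x < d \<longrightarrow> onorm (\<lambda>v. jac f x *v v - jac f a *v v) < e"
    proof (intro exI conjI allI impI)
      show "0 < min R (e / (C + 1))" using R C e by simp
      fix x assume x: "dist a x < min R (e / (C + 1))"
      have "onorm (\<lambda>v. jac f x *v v - jac f a *v v) \<le> C * dist a x"
        using lip x by (intro onorm_le) simp
      also have "\<dots> \<le> (C + 1) * dist a x"
        by (simp add: algebra_simps)
      also have "\<dots> < e"
        using x C by (simp add: field_simps)
      finally show "onorm (\<lambda>v. jac f x *v v - jac f a *v v) < e" .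
    qed
  qed (use that in blast)
qed

lemma continuous_on_inv_into_open:
  fixes f :: "'a::euclidean_space \<Rightarrow> 'a"
  assumes "open S" "continuous_on S f" "inj_on f S"
  shows "continuous_on (f ` S) (inv_into S f)"
proof -
  obtain g where g: "homeomorphism S (f ` S) f g"
    using invariance_of_domain_homeomorphism[OF assms(1,2) _ assms(3)] by blast
  then have "g y = inv_into S f y" if "y \<in> f ` S" for y
    using that assms(3) unfolding homeomorphism_def by (auto simp: inv_into_f_f)
  with homeomorphism_cont2[OF g] show ?thesis
    by (rule continuous_on_eq)
qed

text \<open>The derivative of the inverse is given by the inverse of a complex matrix, so it is
  again complex-linear.\<close>

lemma holomorphic_map_on_inv_into:
  fixes f :: "complex ^ 'n \<Rightarrow> complex ^ 'n"
  assumes f: "holomorphic_map_on f S" and S: "open S" and inj: "inj_on f S"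
    and det: "\<And>z. z \<in> S \<Longrightarrow> det (jac f z) \<noteq> 0"
  shows "holomorphic_map_on (inv_into S f) (f ` S)"
  unfolding holomorphic_map_on_def
proof
  fix y assume "y \<in> f ` S"
  then obtain z where z: "z \<in> S" "y = f z" by blast
  obtain B where B: "jac f z ** B = mat 1"
    using det[OF z(1)] invertible_det_nz[of "jac f z"] invertible_right_inverse[of "jac f z"] by blast
  have "(inv_into S f has_derivative (*v) B) (at (f z))"
  proof (rule has_derivative_inverse_strong[OF S z(1) holomorphic_map_on_continuous_on[OF f]])
    show "inv_into S f (f x) = x" if "x \<in> S" for x
      using inj that by simp
    show "(f has_derivative (*v) (jac f z)) (at z)"
      by (rule holomorphic_map_on_has_derivative[OF f z(1)])
    show "(*v) (jac f z) \<circ> (*v) B = id"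
      using B by (simp add: fun_eq_iff matrix_vector_mul_assoc)
  qed
  then show "\<exists>A. (inv_into S f has_derivative (*v) A) (at y)"
    using z by blast
qed

lemma jac_eq_mat_1:
  fixes h :: "complex ^ 'n \<Rightarrow> complex ^ 'n"
  assumes "open V" "y \<in> V" "\<And>x. x \<in> V \<Longrightarrow> h x = x"
  shows "jac h y = mat 1"
proof (rule jac_unique)
  have "(*v) (mat 1) = (\<lambda>v :: complex ^ 'n. v)"
    by (simp add: fun_eq_iff)
  then have "((\<lambda>x :: complex ^ 'n. x) has_derivative (*v) (mat 1)) (at y)"
    by simp
  then show "(h has_derivative (*v) (mat 1)) (at y)"
    by (rule has_derivative_transform_within_open[OF _ assms(1,2)]) (simp add: assms(3))
qed

lemma holo_coordinate: "holo (\<lambda>z. z $ j) S"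
  unfolding holo_def
  by (intro ballI exI[of _ "\<lambda>v. v $ j"])
    (simp add: bounded_linear_imp_has_derivative[OF bounded_linear_vec_nth])

text \<open>
  Some components of \<open>f\<close> are replaced by coordinates. If the Jacobian of \<open>f\<close> vanished identically,
  a mixed map with a maximal number of \<open>f\<close>-components among those with Jacobian not identically
  zero would serve as a chart in which \<open>f\<close> is constant along a coordinate line.
\<close>

definition mixed_map ::
    "(complex ^ 'n \<Rightarrow> complex ^ 'n) \<Rightarrow> ('n \<Rightarrow> 'n + 'n) \<Rightarrow> complex ^ 'n \<Rightarrow> complex ^ 'n" where
  "mixed_map f q z = (\<chi> i. case q i of Inl j \<Rightarrow> f z $ j | Inr j \<Rightarrow> z $ j)"

lemma mixed_map_holomorphic:
  assumes "holomorphic_map_on f S"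
  shows "holomorphic_map_on (mixed_map f q) S"
  unfolding holomorphic_map_on_iff_holo mixed_map_def vec_lambda_beta
proof
  fix i
  show "holo (\<lambda>z. case q i of Inl j \<Rightarrow> f z $ j | Inr j \<Rightarrow> z $ j) S"
    using assms holo_coordinate by (cases "q i") (auto simp: holomorphic_map_on_iff_holo)
qed

lemma jac_mixed_map_Inl:
  assumes f: "holomorphic_map_on f S" and z: "z \<in> S" and q: "q i = Inl j"
  shows "(jac (mixed_map f q) z *v v) $ i = (jac f z *v v) $ j"
proof -
  have "(jac (mixed_map f q) z *v v) $ i = dir_deriv (\<lambda>z. mixed_map f q z $ i) v z"
    using mixed_map_holomorphic[OF f] z
    by (intro jac_mult_component[where S = S]) (simp_all add: holomorphic_map_on_iff_holo)
  also have "(\<lambda>z. mixed_map f q z $ i) = (\<lambda>z. f z $ j)"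
    by (simp add: mixed_map_def q)
  also have "dir_deriv (\<lambda>z. f z $ j) v z = (jac f z *v v) $ j"
    using f z by (intro jac_mult_component[where S = S, symmetric])
      (simp_all add: holomorphic_map_on_iff_holo)
  finally show ?thesis .
qed

lemma jac_mixed_map_cong:
  assumes f: "holomorphic_map_on f S" and z: "z \<in> S" and q: "q i = q' i"
  shows "(jac (mixed_map f q) z *v v) $ i = (jac (mixed_map f q') z *v v) $ i"
proof -
  have "(jac (mixed_map f q) z *v v) $ i = dir_deriv (\<lambda>z. mixed_map f q z $ i) v z" for q
    using mixed_map_holomorphic[OF f] z
    by (intro jac_mult_component[where S = S]) (simp_all add: holomorphic_map_on_iff_holo)
  then show ?thesis
    using q by (simp add: mixed_map_def)
qed

text \<open>Applied to every small open subset, this shows that the points with nonzero Jacobian are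
  dense, which Osgood's theorem needs.\<close>

lemma injective_imp_jacobian_not_identically_0:
  fixes f :: "complex ^ 'n \<Rightarrow> complex ^ 'n"
  assumes f: "holomorphic_map_on f W" and W: "open W" "W \<noteq> {}" and inj: "inj_on f W"
  shows "\<exists>z\<in>W. det (jac f z) \<noteq> 0"
proof (rule ccontr)
  assume "\<not> ?thesis"
  then have J0: "\<And>z. z \<in> W \<Longrightarrow> det (jac f z) = 0" by blast
  define P where "P = (\<lambda>q. \<exists>z\<in>W. det (jac (mixed_map f q) z) \<noteq> 0)"
  define N where "N = (\<lambda>q :: 'n \<Rightarrow> 'n + 'n. card {i. isl (q i)})"
  \<comment> \<open>With a coordinate in every slot the mixed map is the identity, so there is a
    candidate to maximise over.\<close>
  have "P Inr"
  proof -
    have "jac (mixed_map f Inr) z = mat 1" for z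
      by (rule jac_eq_mat_1[of UNIV]) (simp_all add: mixed_map_def)
    then show ?thesis using W by (auto simp: P_def)
  qed
  moreover have "\<forall>q. P q \<longrightarrow> N q < Suc CARD('n)"
    unfolding N_def by (auto intro!: le_imp_less_Suc card_mono)
  ultimately obtain q where q: "P q" and q_max: "\<And>q'. P q' \<Longrightarrow> N q' \<le> N q"
    using ex_has_greatest_nat[of P Inr N "Suc CARD('n)"] by blast
  define \<Phi> where "\<Phi> = mixed_map f q"
  have hol\<Phi>: "holomorphic_map_on \<Phi> W"
    unfolding \<Phi>_def by (rule mixed_map_holomorphic[OF f])
  obtain z where z: "z \<in> W" "det (jac \<Phi> z) \<noteq> 0"
    using q by (auto simp: P_def \<Phi>_def)
  \<comment> \<open>With components of \<open>f\<close> in all slots, a kernel vector of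
    \<open>jac f z\<close> would also be one of \<open>jac \<Phi> z\<close>. So some slot
    \<open>i0\<close> still holds a coordinate.\<close>
  have "\<exists>i. \<not> isl (q i)"
  proof (rule ccontr)
    assume "\<not> ?thesis"
    then have Inl: "\<exists>j. q i = Inl j" for i by (simp add: isl_def)
    obtain v where v: "v \<noteq> 0" "jac f z *v v = 0"
      using J0[OF z(1)] det_eq_0_iff_kernel by blast
    have "jac \<Phi> z *v v = 0"
      unfolding vec_eq_iff
    proof
      fix i
      obtain j where j: "q i = Inl j" using Inl by blast
      from jac_mixed_map_Inl[of f W z q i j v, OF f z(1) j] v(2)
      show "(jac \<Phi> z *v v) $ i = 0 $ i" by (simp add: \<Phi>_def)
    qed
    then show False
      using v z(2) det_eq_0_iff_kernel by blast
  qed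
  then obtain i0 where i0: "\<not> isl (q i0)" by blast
  define e :: "complex ^ 'n" where "e = axis i0 1"
  \<comment> \<open>By maximality, putting component \<open>k\<close> of \<open>f\<close> into slot
    \<open>i0\<close> makes the Jacobian singular. A kernel vector \<open>x\<close> of the new
    matrix is killed by all other rows of \<open>jac \<Phi> w\<close>, so it is a nonzero multiple
    of \<open>u\<close>; its row \<open>i0\<close> then says that component \<open>k\<close> of
    \<open>jac f w *v u\<close> vanishes.\<close>
  have kernel: "jac f w *v u = 0" if w: "w \<in> W" "det (jac \<Phi> w) \<noteq> 0" and u: "jac \<Phi> w *v u = e" for w u
    unfolding vec_eq_iff
  proof
    fix k
    define q' where "q' = q(i0 := Inl k)"
    have "{i. isl (q' i)} = insert i0 {i. isl (q i)}"
      by (auto simp: q'_def)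
    then have "N q' = Suc (N q)"
      using i0 by (simp add: N_def)
    then have "\<not> P q'"
      using q_max[of q'] by auto
    then have "det (jac (mixed_map f q') w) = 0"
      using w by (auto simp: P_def)
    then obtain x where x: "x \<noteq> 0" "jac (mixed_map f q') w *v x = 0"
      using det_eq_0_iff_kernel by blast
    define c where "c = (jac \<Phi> w *v x) $ i0"
    have "(jac \<Phi> w *v x) $ i = 0" if "i \<noteq> i0" for i
    proof -
      have "(jac \<Phi> w *v x) $ i = (jac (mixed_map f q') w *v x) $ i"
        unfolding \<Phi>_def using that by (intro jac_mixed_map_cong[OF f w(1)]) (simp add: q'_def)
      then show ?thesis using x by simp
    qed
    then have "jac \<Phi> w *v x = c *s e"
      by (simp add: vec_eq_iff e_def axis_def c_def)
    then have "jac \<Phi> w *v (x - c *s u) = 0"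
      using u by (simp add: matrix_vector_mult_diff_distrib vec.scale)
    then have xu: "x = c *s u"
      using w(2) det_eq_0_iff_kernel[of "jac \<Phi> w"] by (metis right_minus_eq)
    have "(jac f w *v x) $ k = (jac (mixed_map f q') w *v x) $ i0"
      by (rule jac_mixed_map_Inl[OF f w(1), symmetric]) (simp add: q'_def)
    then have "(jac f w *v x) $ k = 0"
      using x(2) by simp
    then have "c * (jac f w *v u) $ k = 0"
      unfolding xu by (simp add: vec.scale)
    then show "(jac f w *v u) $ k = 0 $ k"
      using x(1) xu by auto
  qed
  define W' where "W' = {w \<in> W. det (jac \<Phi> w) \<noteq> 0}"
  have "open (W \<inter> (\<lambda>w. det (jac \<Phi> w)) -` (- {0}))"
    using holo_continuous_on[OF holo_det_jac[OF hol\<Phi> W(1)]] W(1)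
    by (intro continuous_open_preimage) auto
  also have "W \<inter> (\<lambda>w. det (jac \<Phi> w)) -` (- {0}) = W'"
    by (auto simp: W'_def)
  finally have W': "open W'" .
  have W'_sub: "W' \<subseteq> W" by (auto simp: W'_def)
  obtain r where r: "r > 0" and T: "ball z r \<subseteq> W'" and inj\<Phi>: "inj_on \<Phi> (ball z r)"
    using holomorphic_map_on_locally_injective[OF holomorphic_map_on_subset[OF hol\<Phi> W'_sub] W', of z]
      z by (auto simp: W'_def)
  define T where "T = ball z r"
  have hT: "holomorphic_map_on \<Phi> T" and "open T" and inj\<Phi>: "inj_on \<Phi> T"
    and TW: "T \<subseteq> W" and detT: "\<And>w. w \<in> T \<Longrightarrow> det (jac \<Phi> w) \<noteq> 0"
    using holomorphic_map_on_subset[OF hol\<Phi>] T inj\<Phi> W'_sub by (auto simp: T_def W'_def)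
  define V where "V = \<Phi> ` T"
  define \<Psi> where "\<Psi> = inv_into T \<Phi>"
  have "open V"
    unfolding V_def
    by (rule invariance_of_domain[OF holomorphic_map_on_continuous_on[OF hT] \<open>open T\<close> inj\<Phi>])
  have h\<Psi>: "holomorphic_map_on \<Psi> V"
    unfolding V_def \<Psi>_def by (rule holomorphic_map_on_inv_into[OF hT \<open>open T\<close> inj\<Phi> detT])
  have \<Psi>T: "\<Psi> y \<in> T" and \<Phi>\<Psi>: "\<Phi> (\<Psi> y) = y" if "y \<in> V" for y
    using that by (auto simp: \<Psi>_def V_def inv_into_into f_inv_into_f)
  have ker\<Psi>: "jac f (\<Psi> y) *v (jac \<Psi> y *v e) = 0" if y: "y \<in> V" for y
  proof (rule kernel)
    show "\<Psi> y \<in> W" "det (jac \<Phi> (\<Psi> y)) \<noteq> 0"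
      using \<Psi>T[OF y] TW detT by auto
    have "jac (\<lambda>y. \<Phi> (\<Psi> y)) y = mat 1"
      by (rule jac_eq_mat_1[OF \<open>open V\<close> y \<Phi>\<Psi>])
    then have "jac \<Phi> (\<Psi> y) ** jac \<Psi> y = mat 1"
      using jac_compose[OF h\<Psi> y hT \<Psi>T[OF y]] by simp
    then show "jac \<Phi> (\<Psi> y) *v (jac \<Psi> y *v e) = e"
      by (simp add: matrix_vector_mul_assoc)
  qed
  define y0 where "y0 = \<Phi> z"
  have "y0 \<in> V"
    using r by (simp add: y0_def V_def T_def)
  then obtain d where d: "d > 0" "cball y0 d \<subseteq> V"
    using \<open>open V\<close> open_contains_cball by blast
  have line: "y0 + t *s e \<in> V" if "t \<in> cball 0 d" for t :: complex
    using that d by (intro subsetD[OF d(2)]) (simp add: dist_norm norm_smult_complex e_def)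
  \<comment> \<open>In the chart \<Psi>, direction \<open>e\<close> is mapped into the kernel of
    \<open>jac f\<close>, so \<open>f \<circ> \<Psi>\<close> is constant on a disc in that
    direction. This contradicts injectivity.\<close>
  have eq: "f (\<Psi> (y0 + of_real d *s e)) = f (\<Psi> (y0 + 0 *s e))"
    unfolding vec_eq_iff
  proof
    fix k
    have holo: "holo (\<lambda>y. f (\<Psi> y) $ k) V"
      by (rule holo_compose[OF h\<Psi>, of "\<lambda>z. f z $ k" W])
        (use f \<Psi>T TW in \<open>auto simp: holomorphic_map_on_iff_holo\<close>)
    have "\<exists>c. \<forall>t\<in>cball (0 :: complex) d. f (\<Psi> (y0 + t *s e)) $ k = c"
    proof (rule has_field_derivative_zero_constant)
      fix t :: complex assume t: "t \<in> cball 0 d"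
      have "((\<lambda>t. f (\<Psi> (y0 + t *s e)) $ k) has_field_derivative
          dir_deriv (\<lambda>y. f (\<Psi> y) $ k) e (y0 + t *s e)) (at t)"
        by (rule holo_line_has_field_derivative[OF holo line[OF t]])
      also have "dir_deriv (\<lambda>y. f (\<Psi> y) $ k) e (y0 + t *s e) = (jac (\<lambda>y. f (\<Psi> y)) (y0 + t *s e) *v e) $ k"
        by (rule jac_mult_component[OF holo line[OF t], symmetric])
      also have "jac (\<lambda>y. f (\<Psi> y)) (y0 + t *s e) = jac f (\<Psi> (y0 + t *s e)) ** jac \<Psi> (y0 + t *s e)"
        using \<Psi>T[OF line[OF t]] TW by (intro jac_compose[OF h\<Psi> line[OF t] f]) auto
      also have "(jac f (\<Psi> (y0 + t *s e)) ** jac \<Psi> (y0 + t *s e)) *v e = 0"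
        using ker\<Psi>[OF line[OF t]] by (simp add: matrix_vector_mul_assoc)
      finally show "((\<lambda>t. f (\<Psi> (y0 + t *s e)) $ k) has_field_derivative 0) (at t within cball 0 d)"
        using has_field_derivative_at_within by simp
    qed simp
    then obtain c where c: "\<And>t. t \<in> cball (0 :: complex) d \<Longrightarrow> f (\<Psi> (y0 + t *s e)) $ k = c"
      by blast
    have "of_real d \<in> cball (0 :: complex) d" "0 \<in> cball (0 :: complex) d"
      using d by auto
    then show "f (\<Psi> (y0 + of_real d *s e)) $ k = f (\<Psi> (y0 + 0 *s e)) $ k"
      by (simp only: c)
  qed
  have V: "y0 + of_real d *s e \<in> V" "y0 + 0 *s e \<in> V"
    using d by (auto intro!: line)
  have "\<Psi> (y0 + of_real d *s e) = \<Psi> (y0 + 0 *s e)"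
    by (rule inj_onD[OF inj eq subsetD[OF TW \<Psi>T[OF V(1)]] subsetD[OF TW \<Psi>T[OF V(2)]]])
  from arg_cong[OF this, of \<Phi>] have "y0 + of_real d *s e = y0 + 0 *s e"
    unfolding \<Phi>\<Psi>[OF V(1)] \<Phi>\<Psi>[OF V(2)] .
  then have "of_real d *s e = 0"
    by simp
  from arg_cong[OF this, of "\<lambda>v. v $ i0"]
  show False
    using d by (simp add: e_def axis_def)
qed

text \<open>A Lipschitz bound for the inverse is proved between points with nonzero Jacobian and
  extended to all points by density and continuity. A kernel vector of the derivative would make
  \<open>f\<close> contract too strongly along it.\<close>

theorem injective_imp_jacobian_nonzero:
  fixes f :: "complex ^ 'n \<Rightarrow> complex ^ 'n"
  assumes f: "holomorphic_map_on f S" and S: "open S" and inj: "inj_on f S" and z0: "z0 \<in> S"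
  shows "det (jac f z0) \<noteq> 0"
proof -
  \<comment> \<open>Shrinking to a ball makes the domain bounded, which bounds the inverse
    \<open>g\<close> in the Schwarz estimate.\<close>
  obtain \<rho> where \<rho>: "\<rho> > 0" "ball z0 \<rho> \<subseteq> S"
    using S z0 open_contains_ball by blast
  define U where "U = ball z0 \<rho>"
  have U: "open U" "z0 \<in> U" and fU: "holomorphic_map_on f U" and injU: "inj_on f U"
    using \<rho> holomorphic_map_on_subset[OF f] inj_on_subset[OF inj] by (auto simp: U_def)
  note contf = holomorphic_map_on_continuous_on[OF fU]
  define J where "J = (\<lambda>z. det (jac f z))"
  have J: "holo J U"
    unfolding J_def by (rule holo_det_jac[OF fU U(1)])
  define V where "V = f ` U"
  define g where "g = inv_into U f"
  have V: "open V"
    unfolding V_def by (rule invariance_of_domain[OF contf U(1) injU])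
  have contg: "continuous_on V g"
    unfolding V_def g_def by (rule continuous_on_inv_into_open[OF U(1) contf injU])
  have gU: "g y \<in> U" and fg: "f (g y) = y" if "y \<in> V" for y
    using that by (auto simp: g_def V_def inv_into_into f_inv_into_f)
  have gf: "g (f z) = z" "f z \<in> V" if "z \<in> U" for z
    using that injU by (auto simp: g_def V_def)
  define h where "h = (\<lambda>y. J (g y))"
  have conth: "continuous_on V h"
    unfolding h_def using gU by (intro continuous_on_compose2[OF holo_continuous_on[OF J] contg]) auto
  define Q where "Q = {y \<in> V. h y \<noteq> 0}"
  have gQ: "holomorphic_map_on g Q"
  proof -
    define U' where "U' = {z \<in> U. J z \<noteq> 0}"
    have "open (U \<inter> J -` (- {0}))"
      using holo_continuous_on[OF J] U(1) by (intro continuous_open_preimage) auto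
    also have "U \<inter> J -` (- {0}) = U'"
      by (auto simp: U'_def)
    finally have U': "open U'" .
    have inj': "inj_on f U'"
      using injU by (auto simp: U'_def inj_on_def)
    have "holomorphic_map_on (inv_into U' f) (f ` U')"
      using holomorphic_map_on_subset[OF fU] U' inj'
      by (intro holomorphic_map_on_inv_into) (auto simp: U'_def J_def)
    moreover have fU': "f ` U' = Q"
      using gf gU fg by (force simp: U'_def Q_def h_def)
    moreover have "open (f ` U')"
      using invariance_of_domain[OF _ U' inj'] continuous_on_subset[OF contf] by (auto simp: U'_def)
    moreover have "inv_into U' f y = g y" if "y \<in> Q" for y
    proof -
      have "g y \<in> U'" "f (g y) = y"
        using that gU fg by (auto simp: U'_def Q_def h_def)
      then show ?thesis
        using inv_into_f_f[OF inj', of "g y"] by simp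
    qed
    ultimately have *: "holomorphic_map_on (inv_into U' f) Q" "open Q"
      and eq: "\<And>y. y \<in> Q \<Longrightarrow> inv_into U' f y = g y"
      by auto
    show ?thesis
      unfolding holomorphic_map_on_def
    proof (intro ballI exI)
      fix y assume y: "y \<in> Q"
      show "(g has_derivative (*v) (jac (inv_into U' f) y)) (at y)"
        by (rule has_derivative_transform_within_open[OF
              holomorphic_map_on_has_derivative[OF *(1) y] *(2) y eq])
    qed
  qed
  have hQ: "holo h Q"
    unfolding h_def by (rule holo_compose[OF gQ J]) (auto simp: Q_def gU)
  obtain R0 where R0: "R0 > 0" "cball (f z0) R0 \<subseteq> V"
    using V gf(2)[OF U(2)] open_contains_cball by blast
  define R where "R = R0 / 2"
  have R: "R > 0" "cball (f z0) (2 * R) \<subseteq> V"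
    using R0 by (simp_all add: R_def)
  define M where "M = norm z0 + \<rho>"
  have gM: "norm (g y) \<le> M" if "y \<in> V" for y
    using gU[OF that] norm_triangle_sub[of "g y" z0] by (simp add: U_def M_def dist_norm norm_minus_commute)
  define C where "C = real CARD('n) * (2 * M / R)"
  have C0: "C \<ge> 0"
    using R \<rho> by (simp add: C_def M_def)
  \<comment> \<open>Only the two end points have to avoid the zeros of \<open>h\<close>; the complex
    line through them may meet such zeros.\<close>
  have lipQ: "norm (g y' - g y) \<le> C * norm (y' - y)"
    if y: "y \<in> Q" "y' \<in> Q" "y \<in> ball (f z0) R" "norm (y' - y) \<le> R" for y y'
  proof (cases "y' = y")
    case False
    define v where "v = y' - y"
    have v: "v \<noteq> 0" using False by (simp add: v_def)
    define r where "r = R / norm v"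
    have r: "r > 0" using R v by (simp add: r_def)
    have sub: "cball y R \<subseteq> V"
      using y(3) R by (intro order_trans[OF _ R(2)])
        (auto simp: cball_subset_cball_iff dist_commute)
    have line: "y + t *s v \<in> V" if "t \<in> cball 0 r" for t
      using that v by (intro subsetD[OF sub])
        (simp add: r_def dist_norm norm_smult_complex field_simps)
    have Wsub: "{t \<in> ball 0 r. h (y + t *s v) \<noteq> 0} \<subseteq> {t. y + t *s v \<in> Q}"
      using line by (auto simp: Q_def)
    have "norm (g y' - g y) \<le> real CARD('n) * (2 * M / r * cmod 1)"
    proof (rule norm_vec_le_card)
      fix i
      have "cmod (g (y + 1 *s v) $ i - g (y + 0 *s v) $ i) \<le> 2 * M / r * cmod 1"
      proof (rule schwarz_off_zeros[where u = "\<lambda>t. g (y + t *s v) $ i" and h = "\<lambda>t. h (y + t *s v)" and M = M])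
        show "continuous_on (cball 0 r) (\<lambda>t. g (y + t *s v) $ i)"
          using line by (intro continuous_on_component
              continuous_on_compose2[OF contg continuous_on_complex_line]) auto
        show "continuous_on (cball 0 r) (\<lambda>t. h (y + t *s v))"
          using line by (intro continuous_on_compose2[OF conth continuous_on_complex_line]) auto
        show "(\<lambda>t. g (y + t *s v) $ i) holomorphic_on {t \<in> ball 0 r. h (y + t *s v) \<noteq> 0}"
          using gQ by (intro holomorphic_on_subset[OF holo_line_holomorphic Wsub])
            (simp add: holomorphic_map_on_iff_holo)
        show "(\<lambda>t. h (y + t *s v)) holomorphic_on {t \<in> ball 0 r. h (y + t *s v) \<noteq> 0}"
          by (rule holomorphic_on_subset[OF holo_line_holomorphic[OF hQ] Wsub])
        show "cmod (g (y + t *s v) $ i) \<le> M" if "t \<in> cball 0 r" for t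
          by (rule order_trans[OF Finite_Cartesian_Product.norm_nth_le gM[OF line[OF that]]])
        show "h (y + 0 *s v) \<noteq> 0" "h (y + 1 *s v) \<noteq> 0"
          using y by (simp_all add: Q_def v_def)
        show "1 \<in> cball (0 :: complex) r"
          using v y(4) by (simp add: r_def v_def)
      qed (rule r)
      then show "cmod ((g y' - g y) $ i) \<le> 2 * M / r * cmod 1"
        by (simp add: v_def)
    qed
    then show ?thesis
      by (simp add: C_def r_def v_def)
  qed simp
  \<comment> \<open>With the radius \<open>R / 2\<close>, the images of two points of
    \<open>N\<close> differ by at most \<open>R\<close>, as \<open>lipQ\<close> requires.\<close>
  define N where "N = {z \<in> U. f z \<in> ball (f z0) (R / 2)}"
  have "open (U \<inter> f -` ball (f z0) (R / 2))"
    using contf U by (intro continuous_open_preimage) auto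
  also have "U \<inter> f -` ball (f z0) (R / 2) = N"
    by (auto simp: N_def)
  finally have N: "open N" .
  have NU: "N \<subseteq> U" and z0N: "z0 \<in> N"
    using U R by (auto simp: N_def)
  have lip: "norm (z' - z) \<le> C * norm (f z' - f z)" if z: "z \<in> N" "z' \<in> N" for z z'
  proof (rule ccontr)
    assume neg: "\<not> ?thesis"
    \<comment> \<open>Failure of the bound is the open condition \<open>D > 0\<close>, so it
      persists at a nearby pair with nonzero Jacobians, where \<open>lipQ\<close> refutes
      it.\<close>
    define D where "D = (\<lambda>p. norm (snd p - fst p) - C * norm (f (snd p) - f (fst p)))"
    have contN: "continuous_on N f"
      by (rule continuous_on_subset[OF contf NU])
    have "continuous_on (N \<times> N) (\<lambda>p. f (fst p))" "continuous_on (N \<times> N) (\<lambda>p. f (snd p))"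
      by (auto intro!: continuous_on_compose2[OF contN] continuous_intros)
    then have "continuous_on (N \<times> N) D"
      unfolding D_def by (intro continuous_intros)
    then have "open ((N \<times> N) \<inter> D -` {0<..})"
      using N by (intro continuous_open_preimage open_Times) auto
    moreover have "(z, z') \<in> (N \<times> N) \<inter> D -` {0<..}"
      using z neg by (simp add: D_def)
    ultimately obtain A B where A: "open A" "z \<in> A" and B: "open B" "z' \<in> B"
      and AB: "A \<times> B \<subseteq> (N \<times> N) \<inter> D -` {0<..}"
      by (rule open_prod_elim) auto
    have AN: "A \<subseteq> N" and BN: "B \<subseteq> N"
      using AB A B by auto
    have dense: "\<exists>a\<in>A. J a \<noteq> 0" if "open A" "A \<noteq> {}" "A \<subseteq> N" for A
      unfolding J_def using that NU holomorphic_map_on_subset[OF fU] inj_on_subset[OF injU]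
      by (intro injective_imp_jacobian_not_identically_0) (auto dest: order_trans)
    obtain a b where a: "a \<in> A" "J a \<noteq> 0" and b: "b \<in> B" "J b \<noteq> 0"
      using dense A B AN BN by (metis empty_iff)
    have ab: "a \<in> N" "b \<in> N" using a b AN BN by auto
    have "norm (g (f b) - g (f a)) \<le> C * norm (f b - f a)"
    proof (rule lipQ)
      show "f a \<in> Q" "f b \<in> Q"
        using ab NU a b gf by (auto simp: Q_def h_def)
      show "f a \<in> ball (f z0) R"
        using ab R by (simp add: N_def)
      show "norm (f b - f a) \<le> R"
        using ab dist_triangle2[of "f b" "f a" "f z0"] by (simp add: N_def dist_norm norm_minus_commute)
    qed
    moreover have "g (f a) = a" "g (f b) = b"
      using ab NU gf by auto
    moreover have "(a, b) \<in> D -` {0<..}"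
      using AB a b by auto
    ultimately show False
      by (simp add: D_def)
  qed
  show ?thesis
  proof
    assume "det (jac f z0) = 0"
    then obtain v where v: "v \<noteq> 0" "jac f z0 *v v = 0"
      using det_eq_0_iff_kernel by blast
    \<comment> \<open>Chosen to make \<open>C * c < 1\<close>: along the kernel vector
      \<open>f\<close> moves by at most \<open>c\<close> times the displacement, while the Lipschitz
      bound allows a loss of at most the factor \<open>C\<close>.\<close>
    define c where "c = 1 / (2 * (C + 1))"
    have c: "c > 0" "C * c < 1" using C0 by (simp_all add: c_def)
    obtain d where d: "d > 0" "\<And>y. norm (y - z0) < d \<Longrightarrow>
        norm (f y - f z0 - jac f z0 *v (y - z0)) \<le> c * norm (y - z0)"
      using holomorphic_map_on_has_derivative[OF fU U(2)] c(1) unfolding has_derivative_at_alt by blast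
    obtain d' where d': "d' > 0" "ball z0 d' \<subseteq> N"
      using N z0N open_contains_ball by blast
    define t where "t = min d d' / (2 * norm v)"
    have t: "t > 0" using d d' v by (simp add: t_def)
    define y where "y = z0 + t *\<^sub>R v"
    have ny: "norm (y - z0) = min d d' / 2"
      using t v d d' by (simp add: y_def t_def)
    have ny_less: "norm (y - z0) < d"
      unfolding ny using d(1) d'(1) by linarith
    have "jac f z0 *v (y - z0) = 0"
      using v(2) by (simp add: y_def scaleR_eq_smult vec.scale)
    then have 1: "norm (f y - f z0) \<le> c * norm (y - z0)"
      using d(2)[OF ny_less] by simp
    have "y \<in> ball z0 d'"
      using ny d d' by (simp add: dist_norm norm_minus_commute)
    then have "norm (y - z0) \<le> C * norm (f y - f z0)"
      using d'(2) z0N by (intro lip) auto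
    also have "\<dots> \<le> C * (c * norm (y - z0))"
      using 1 C0 by (intro mult_left_mono)
    also have "\<dots> = (C * c) * norm (y - z0)" by simp
    also have "\<dots> < 1 * norm (y - z0)"
      using c ny d d' by (intro mult_strict_right_mono) auto
    finally show False by simp
  qed
qed

section \<open>Limits of injective holomorphic maps\<close>

text \<open>A topological stand-in for Rouche's theorem. Near \<open>a\<close> the map
  \<open>f\<close> has a continuous inverse, so \<open>F n\<close> composed with it is a small
  perturbation of the identity on a closed ball, and Brouwer's theorem solves the equation.\<close>

lemma eventually_attains_limit_value:
  fixes f :: "'a::euclidean_space \<Rightarrow> 'a"
  assumes lim: "loc_unif F f S" and S: "open S" and F: "\<And>n. continuous_on S (F n)"
    and r: "r > 0" "ball a r \<subseteq> S" and inj: "inj_on f (ball a r)"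
  shows "\<forall>\<^sub>F n in sequentially. f a \<in> F n ` ball a r"
proof -
  have contf: "continuous_on S f"
    by (rule loc_unif_continuous_on[OF lim S F])
  define e where "e = r / 2"
  have e: "e > 0" "cball a e \<subseteq> ball a r"
    using r by (auto simp: e_def)
  have contb: "continuous_on (ball a r) f" and injc: "inj_on f (cball a e)"
    using continuous_on_subset[OF contf r(2)] inj_on_subset[OF inj e(2)] by auto
  have "open (f ` ball a e)"
    using e by (intro invariance_of_domain continuous_on_subset[OF contb] inj_on_subset[OF inj]) auto
  moreover have "f a \<in> f ` ball a e"
    using e by simp
  ultimately obtain d where d: "d > 0" "cball (f a) d \<subseteq> f ` ball a e"
    using open_contains_cball by blast
  have sub: "cball (f a) d \<subseteq> f ` cball a e"
    using d(2) by (meson ball_subset_cball image_mono order_trans)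
  define \<phi> where "\<phi> = the_inv_into (cball a e) f"
  have "continuous_on (f ` cball a e) \<phi>"
    unfolding \<phi>_def using injc by (intro continuous_on_inv_into continuous_on_subset[OF contb e(2)]) auto
  then have cont\<phi>: "continuous_on (cball (f a) d) \<phi>"
    by (rule continuous_on_subset[OF _ sub])
  have \<phi>: "\<phi> w \<in> cball a e" "f (\<phi> w) = w" if "w \<in> cball (f a) d" for w
    using the_inv_into_into[OF injc, of w "cball a e"] f_the_inv_into_f[OF injc, of w] that sub
    by (auto simp: \<phi>_def)
  have "uniform_limit (cball a e) F f sequentially"
    using e r by (intro loc_unifD[OF lim]) auto
  from uniform_limitD[OF this d(1)]
  show ?thesis
  proof (rule eventually_mono)
    fix n assume n: "\<forall>z\<in>cball a e. dist (F n z) (f z) < d"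
    \<comment> \<open>a fixed point of \<open>T\<close> is mapped by \<open>\<phi>\<close> to a solution of \<open>F n z = f a\<close>\<close>
    define T where "T = (\<lambda>w. w - F n (\<phi> w) + f a)"
    obtain w where w: "w \<in> cball (f a) d" "T w = w"
    proof (rule brouwer_ball[of d "f a" T])
      show "continuous_on (cball (f a) d) T"
        unfolding T_def using \<phi>(1) e r
        by (intro continuous_intros continuous_on_compose2[OF F cont\<phi>]) blast
      show "T \<in> cball (f a) d \<rightarrow> cball (f a) d"
      proof
        fix w assume w: "w \<in> cball (f a) d"
        have "dist (f a) (T w) = dist (F n (\<phi> w)) (f (\<phi> w))"
          using \<phi>(2)[OF w] by (simp add: T_def dist_norm algebra_simps)
        then show "T w \<in> cball (f a) d"
          using n \<phi>(1)[OF w] by (simp add: less_imp_le)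
      qed
    qed (use d in auto)
    then have "F n (\<phi> w) = f a"
      by (simp add: T_def algebra_simps)
    moreover have "\<phi> w \<in> ball a r"
      using \<phi>(1)[OF w(1)] e by blast
    ultimately show "f a \<in> F n ` ball a r"
      by (metis imageI)
  qed
qed

text \<open>The set where the limit Jacobian vanishes is shown to be open as well as its complement,
  and \<open>S\<close> is connected. The Jacobians of the \<open>F n\<close> have no zeros by
  Osgood's theorem, so Hurwitz's theorem applies to their restrictions to lines.\<close>

lemma limit_jacobian_nonzero:
  fixes F :: "nat \<Rightarrow> complex ^ 'n \<Rightarrow> complex ^ 'n"
  assumes S: "open S" "connected S" and F: "\<And>n. holomorphic_map_on (F n) S"
    and inj: "\<And>n. inj_on (F n) S" and lim: "loc_unif F f S"
    and a: "a \<in> S" "det (jac f a) \<noteq> 0" and z: "z \<in> S"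
  shows "det (jac f z) \<noteq> 0"
proof -
  define J where "J = (\<lambda>z. det (jac f z))"
  have f: "holomorphic_map_on f S"
    by (rule loc_unif_holomorphic_map_on[OF lim S(1) F])
  have J: "holo J S"
    unfolding J_def by (rule holo_det_jac[OF f S(1)])
  have limJ: "loc_unif (\<lambda>n z. det (jac (F n) z)) J S"
    unfolding J_def by (rule loc_unif_det_jac[OF lim S(1) F])
  have nz: "det (jac (F n) z) \<noteq> 0" if "z \<in> S" for n z
    by (rule injective_imp_jacobian_nonzero[OF F S(1) inj that])
  \<comment> \<open>The line runs from \<open>w\<close> at parameter 0 to \<open>z\<close> at
    parameter 1; a constant restriction is nonzero because of its value at \<open>w\<close>.
    Parameters of modulus below 2 stay within \<open>3 * \<rho>\<close> of \<open>z\<close>.\<close>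
  have nearby: "J z \<noteq> 0" if sub: "ball z (4 * \<rho>) \<subseteq> S" and w: "w \<in> ball z \<rho>" "J w \<noteq> 0" for z w \<rho>
  proof -
    define v where "v = z - w"
    define T :: "complex set" where "T = ball 0 2"
    have line: "w + t *s v \<in> S" if "t \<in> T" for t
    proof (rule subsetD[OF sub])
      have "norm (t *s v) \<le> 2 * \<rho>"
        using that w(1) unfolding norm_smult_complex
        by (intro mult_mono) (auto simp: T_def v_def dist_norm)
      moreover have eq: "z - (w + t *s v) = v - t *s v"
        by (simp add: v_def)
      moreover have "norm v < \<rho>"
        using w(1) by (simp add: v_def dist_norm)
      ultimately show "w + t *s v \<in> ball z (4 * \<rho>)"
        using norm_triangle_ineq4[of v "t *s v"] norm_ge_zero[of v]
        unfolding mem_ball dist_norm eq by linarith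
    qed
    have T: "T \<subseteq> {t. w + t *s v \<in> S}"
      using line by auto
    show ?thesis
    proof (cases "(\<lambda>t. J (w + t *s v)) constant_on T")
      case True
      then have "J (w + 1 *s v) = J (w + 0 *s v)"
        unfolding constant_on_def by (metis (no_types, lifting) T_def centre_in_ball
            dist_0_norm mem_ball norm_one one_less_numeral_iff semiring_norm(76) zero_less_numeral)
      then show ?thesis
        using w by (simp add: v_def)
    next
      case False
      have "J (w + 1 *s v) \<noteq> 0"
      proof (rule Hurwitz_no_zeros[OF _ _ _ _ _ False, where ?z0.0 = 1
              and \<F> = "\<lambda>n t. det (jac (F n) (w + t *s v))"])
        show "open T" "connected T" "1 \<in> T" by (auto simp: T_def)
        show "(\<lambda>t. det (jac (F n) (w + t *s v))) holomorphic_on T" for n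
          using holomorphic_on_subset[OF holo_line_holomorphic[OF holo_det_jac[OF F S(1)]] T] .
        show "(\<lambda>t. J (w + t *s v)) holomorphic_on T"
          using holomorphic_on_subset[OF holo_line_holomorphic[OF J] T] .
        show "det (jac (F n) (w + t *s v)) \<noteq> 0" if "t \<in> T" for n t
          by (rule nz[OF line[OF that]])
        fix K assume K: "compact K" "K \<subseteq> T"
        have "uniform_limit ((\<lambda>t. w + t *s v) ` K) (\<lambda>n z. det (jac (F n) z)) J sequentially"
          using K line
          by (intro loc_unifD[OF limJ] compact_continuous_image continuous_on_complex_line) auto
        then show "uniform_limit K (\<lambda>n t. det (jac (F n) (w + t *s v))) (\<lambda>t. J (w + t *s v)) sequentially"
          unfolding uniform_limit_iff by simp
      qed
      then show ?thesis
        by (simp add: v_def)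
    qed
  qed
  have "open (S \<inter> J -` (- {0}))"
    by (rule continuous_open_preimage[OF holo_continuous_on[OF J] S(1)]) auto
  moreover have "open (S \<inter> J -` {0})"
    unfolding open_contains_ball
  proof
    fix z assume z: "z \<in> S \<inter> J -` {0}"
    then obtain R where R: "R > 0" "ball z R \<subseteq> S"
      using S(1) open_contains_ball by blast
    define \<rho> where "\<rho> = R / 4"
    have "J w = 0" if "w \<in> ball z \<rho>" for w
      using nearby[of z \<rho> w] R z that by (auto simp: \<rho>_def)
    moreover have "ball z \<rho> \<subseteq> ball z R"
      using R by (intro subset_ball) (simp add: \<rho>_def)
    ultimately show "\<exists>e>0. ball z e \<subseteq> S \<inter> J -` {0}"
      using R by (intro exI[of _ \<rho>]) (auto simp: \<rho>_def)
  qed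
  ultimately have "S \<inter> J -` (- {0}) \<inter> S = {} \<or> S \<inter> J -` {0} \<inter> S = {}"
    by (intro connectedD[OF S(2)]) auto
  then show ?thesis
    using a z by (auto simp: J_def)
qed

text \<open>If \<open>f\<close> took one value at two points, a single late \<open>F n\<close> would
  take that value in disjoint balls around both. The second claim is what keeps limits of inverse
  maps inside the domain.\<close>

lemma limit_of_injective_maps:
  fixes F :: "nat \<Rightarrow> complex ^ 'n \<Rightarrow> complex ^ 'n"
  assumes S: "open S" "connected S" and F: "\<And>n. holomorphic_map_on (F n) S"
    and inj: "\<And>n. inj_on (F n) S" and lim: "loc_unif F f S"
    and a: "a \<in> S" "det (jac f a) \<noteq> 0"
  shows "inj_on f S" and "\<And>z. z \<in> S \<Longrightarrow> \<forall>\<^sub>F n in sequentially. f z \<in> F n ` S"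
proof -
  have f: "holomorphic_map_on f S"
    by (rule loc_unif_holomorphic_map_on[OF lim S(1) F])
  have cont: "continuous_on S (F n)" for n
    by (rule holomorphic_map_on_continuous_on[OF F])
  have local_surj: "\<exists>r>0. r \<le> e \<and> ball z r \<subseteq> S \<and> (\<forall>\<^sub>F n in sequentially. f z \<in> F n ` ball z r)"
    if z: "z \<in> S" and e: "e > 0" for z e
  proof -
    obtain r where r: "r > 0" "ball z r \<subseteq> S" "inj_on f (ball z r)"
      using holomorphic_map_on_locally_injective[OF f S(1) z]
        limit_jacobian_nonzero[OF S F inj lim a z] by blast
    define r' where "r' = min r e"
    have r': "r' > 0" "r' \<le> e" "ball z r' \<subseteq> ball z r"
      using r e by (auto simp: r'_def)
    then show ?thesis
      using r eventually_attains_limit_value[OF lim S(1) cont r'(1)] inj_on_subset[OF r(3) r'(3)]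
      by (intro exI[of _ r']) auto
  qed
  show "\<forall>\<^sub>F n in sequentially. f z \<in> F n ` S" if z: "z \<in> S" for z
  proof -
    obtain r where r: "ball z r \<subseteq> S" "\<forall>\<^sub>F n in sequentially. f z \<in> F n ` ball z r"
      using local_surj[OF z zero_less_one] by blast
    from r(2) show ?thesis
      by (rule eventually_mono) (use r(1) in blast)
  qed
  show "inj_on f S"
  proof (rule inj_onI, rule ccontr)
    fix y z assume yz: "y \<in> S" "z \<in> S" "f y = f z" "y \<noteq> z"
    \<comment> \<open>Half the distance makes the two balls disjoint.\<close>
    define e where "e = dist y z / 2"
    have e: "e > 0" using yz by (simp add: e_def)
    obtain r where r: "r \<le> e" "ball y r \<subseteq> S" "\<forall>\<^sub>F n in sequentially. f y \<in> F n ` ball y r"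
      using local_surj[OF yz(1) e] by blast
    obtain s where s: "s \<le> e" "ball z s \<subseteq> S" "\<forall>\<^sub>F n in sequentially. f z \<in> F n ` ball z s"
      using local_surj[OF yz(2) e] by blast
    obtain n where "f y \<in> F n ` ball y r" "f z \<in> F n ` ball z s"
      using eventually_happens'[OF sequentially_bot eventually_conj[OF r(3) s(3)]] by blast
    then obtain y' z' where y': "y' \<in> ball y r" "F n y' = f y" and z': "z' \<in> ball z s" "F n z' = f z"
      by auto
    have "y' = z'"
    proof (rule inj_onD[OF inj[of n]])
      show "F n y' = F n z'" using y' z' yz(3) by simp
      show "y' \<in> S" "z' \<in> S" using y' z' r(2) s(2) by blast+
    qed
    then have "dist y z < r + s"
      using y' z' dist_triangle2[of y z y'] by (simp add: dist_commute)
    then show False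
      using r(1) s(1) by (simp add: e_def)
  qed
qed

text \<open>The limit \<open>g\<close> of the inverses is a right inverse of \<open>f\<close>
  wherever its values lie in \<open>D\<close>. This holds near 0 first, which gives the nonzero
  Jacobians; these in turn place all values of \<open>g\<close> in \<open>D\<close>.\<close>

lemma limit_covers_ball:
  fixes F :: "nat \<Rightarrow> complex ^ 'n \<Rightarrow> complex ^ 'n"
  assumes D: "open D" "bounded D" and F: "\<And>n. holomorphic_map_on (F n) D"
    and inj: "\<And>n. inj_on (F n) D" and x: "x \<in> D" and F0: "\<And>n. F n x = 0"
    and r: "r > 0" and cover: "\<And>n. ball 0 r \<subseteq> F n ` D" and lim: "loc_unif F f D"
  shows "ball 0 r \<subseteq> f ` D" and "det (jac f x) \<noteq> 0"
proof -
  define U :: "(complex ^ 'n) set" where "U = ball 0 r"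
  have U: "open U" "connected U" "0 \<in> U"
    using r by (auto simp: U_def)
  define G where "G = (\<lambda>n. inv_into D (F n))"
  have G: "holomorphic_map_on (G n) U" for n
    unfolding G_def U_def
    by (intro holomorphic_map_on_subset[OF holomorphic_map_on_inv_into[OF F D(1) inj] cover]
        injective_imp_jacobian_nonzero[OF F D(1) inj])
  have GD: "G n w \<in> D" and FG: "F n (G n w) = w" if "w \<in> U" for n w
    using cover[of n] that by (auto simp: G_def U_def inv_into_into f_inv_into_f subset_iff)
  have injG: "inj_on (G n) U" for n
    by (rule inj_on_inverseI[of U "F n"]) (rule FG)
  obtain B where B: "\<And>z. z \<in> D \<Longrightarrow> norm z \<le> B"
    using D(2) unfolding bounded_iff by blast
  obtain k g where k: "strict_mono (k :: nat \<Rightarrow> nat)" and g: "loc_unif (\<lambda>n. G (k n)) g U"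
    by (rule montel_maps[OF U(1) G B[OF GD]])
  have limk: "loc_unif (\<lambda>n. F (k n)) f D"
    by (rule loc_unif_subseq[OF lim k])
  have contf: "continuous_on D f"
    by (rule loc_unif_continuous_on[OF lim D(1) holomorphic_map_on_continuous_on[OF F]])
  have hf: "holomorphic_map_on f D"
    by (rule loc_unif_holomorphic_map_on[OF lim D(1) F])
  have hg: "holomorphic_map_on g U"
    by (rule loc_unif_holomorphic_map_on[OF g U(1) G])
  \<comment> \<open>The argument \<open>G (k n) w\<close> moves with \<open>n\<close>; uniform
    convergence on a ball around \<open>g w\<close> absorbs this.\<close>
  have fg: "f (g w) = w" if w: "w \<in> U" "g w \<in> D" for w
  proof (rule LIMSEQ_unique)
    have lim_g: "(\<lambda>n. G (k n) w) \<longlonglongrightarrow> g w"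
      by (rule loc_unif_tendsto[OF g w(1)])
    obtain e where e: "e > 0" "cball (g w) e \<subseteq> D"
      using D(1) w(2) open_contains_cball by blast
    have u: "uniform_limit (cball (g w) e) (\<lambda>n. F (k n)) f sequentially"
      using loc_unifD[OF limk compact_cball e(2)] .
    have near: "\<forall>\<^sub>F n in sequentially. G (k n) w \<in> cball (g w) e"
      using tendstoD[OF lim_g e(1)] by (rule eventually_mono) (simp add: dist_commute less_imp_le)
    have "(\<lambda>n. f (G (k n) w)) \<longlonglongrightarrow> f (g w)"
      using contf D(1) w(2) lim_g by (metis continuous_on_eq_continuous_at isCont_tendsto_compose)
    moreover have "(\<lambda>n. F (k n) (G (k n) w) - f (G (k n) w)) \<longlonglongrightarrow> 0"
    proof (rule tendstoI)
      fix \<epsilon> :: real assume "\<epsilon> > 0"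
      from eventually_conj[OF uniform_limitD[OF u this] near]
      show "\<forall>\<^sub>F n in sequentially. dist (F (k n) (G (k n) w) - f (G (k n) w)) 0 < \<epsilon>"
        by (rule eventually_mono) (auto simp: dist_norm)
    qed
    ultimately have "(\<lambda>n. F (k n) (G (k n) w) - f (G (k n) w) + f (G (k n) w)) \<longlonglongrightarrow> 0 + f (g w)"
      by (intro tendsto_add)
    then show "(\<lambda>n. w) \<longlonglongrightarrow> f (g w)"
      by (simp add: FG[OF w(1)])
  qed (rule tendsto_const)
  have G0: "G n 0 = x" for n
    using F0[of n] inj[of n] x unfolding G_def by (metis inv_into_f_f)
  have g0: "g 0 = x"
    using loc_unif_tendsto[OF g U(3)] by (simp add: G0 LIMSEQ_const_iff)
  \<comment> \<open>A neighbourhood of 0 on which \<open>f \<circ> g\<close> is the identity, so the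
    chain rule makes the two determinants multiply to 1.\<close>
  define N where "N = U \<inter> g -` D"
  have N: "open N" "0 \<in> N"
    unfolding N_def using holomorphic_map_on_continuous_on[OF hg] U D(1) x g0
    by (auto intro!: continuous_open_preimage)
  have "jac (\<lambda>w. f (g w)) 0 = mat 1"
    by (rule jac_eq_mat_1[OF N]) (auto simp: N_def fg)
  moreover have "jac (\<lambda>w. f (g w)) 0 = jac f (g 0) ** jac g 0"
    using g0 x by (intro jac_compose[OF hg U(3) hf]) simp
  ultimately have "det (jac f x) * det (jac g 0) = 1"
    using g0 by (metis det_I det_mul)
  then have dets: "det (jac f x) \<noteq> 0" "det (jac g 0) \<noteq> 0"
    by auto
  show "det (jac f x) \<noteq> 0"
    by (rule dets(1))
  \<comment> \<open>Each \<open>g w\<close> is a value of some injective \<open>G (k n)\<close>, and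
    those take their values in \<open>D\<close>; this excludes the boundary.\<close>
  show "ball 0 r \<subseteq> f ` D"
  proof
    fix w assume "w \<in> ball (0 :: complex ^ 'n) r"
    then have w: "w \<in> U" by (simp add: U_def)
    have "\<forall>\<^sub>F n in sequentially. g w \<in> G (k n) ` U"
      by (rule limit_of_injective_maps(2)[OF U(1,2) G injG g U(3) dets(2) w])
    then obtain n where "g w \<in> G (k n) ` U"
      using eventually_happens'[OF sequentially_bot] by blast
    then have "g w \<in> D"
      using GD by auto
    then show "w \<in> f ` D"
      using fg[OF w] by (metis imageI)
  qed
qed

section \<open>Existence of an extremal embedding\<close>

lemma holomorphic_embedding_exists:
  fixes D :: "(complex ^ 'n) set"
  assumes "bounded_domain D" "x \<in> D"
  shows "\<exists>f. holomorphic_embedding D (ball 0 1) f \<and> f x = 0"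
proof -
  obtain B where B: "\<And>z. z \<in> D \<Longrightarrow> norm z \<le> B"
    using assms unfolding bounded_domain_def bounded_iff by blast
  \<comment> \<open>\<open>B + norm x\<close> bounds \<open>norm (z - x)\<close> on
    \<open>D\<close>, and the summand 1 keeps the denominator positive.\<close>
  define c where "c = 1 / (2 * (B + norm x + 1))"
  have pos: "B + norm x + 1 > 0"
    using order_trans[OF norm_ge_zero B[OF assms(2)]] by (simp add: add_nonneg_pos)
  then have c: "c > 0" by (simp add: c_def)
  define f where "f = (\<lambda>z. c *\<^sub>R (z - x))"
  have "norm (f z) < 1" if "z \<in> D" for z
  proof -
    have "norm (z - x) \<le> B + norm x"
      using norm_triangle_ineq4[of z x] B[OF that] by simp
    then have "norm (f z) \<le> c * (B + norm x)"
      using c by (simp add: f_def)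
    also have "\<dots> < 1"
      using pos by (simp add: c_def field_simps)
    finally show ?thesis .
  qed
  moreover have "holomorphic_map_on f D"
    unfolding holomorphic_map_on_def
  proof (intro ballI exI)
    fix z assume "z \<in> D"
    have "(f has_derivative (\<lambda>v. c *\<^sub>R v)) (at z)"
      unfolding f_def by (auto intro!: derivative_eq_intros)
    also have "(\<lambda>v :: complex ^ 'n. c *\<^sub>R v) = (\<lambda>v. mat (of_real c) *v v)"
      unfolding scaleR_eq_smult
      by (simp add: fun_eq_iff vec_eq_iff matrix_vector_mult_def mat_def mult_delta_left)
    finally show "(f has_derivative (*v) (mat (of_real c))) (at z)" .
  qed
  moreover have "inj f"
    using c by (auto simp: f_def inj_on_def)
  moreover have "open (f ` U)" if "open U" for U
    using \<open>inj f\<close> that unfolding f_def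
    by (intro invariance_of_domain[OF _ that] continuous_intros) (auto simp: inj_on_def)
  ultimately have "holomorphic_embedding D (ball 0 1) f \<and> f x = 0"
    unfolding holomorphic_embedding_def by (auto simp: f_def inj_on_def)
  then show ?thesis by blast
qed

theorem theorem2p1:
  fixes D :: "(complex ^ 'n) set" and x :: "complex ^ 'n"
  assumes "bounded_domain D" and "x \<in> D"
  shows "\<exists>f. holomorphic_embedding D (ball 0 1) f \<and> f x = 0 \<and>
           ball 0 (squeezing_function D x) \<subseteq> f ` D"
proof -
  have D: "open D" "connected D" "bounded D"
    using assms(1) by (auto simp: bounded_domain_def)
  define E where "E = {f. holomorphic_embedding D (ball 0 1) f \<and> f x = 0}"
  define s where "s = squeezing_function D x"
  have s_eq: "s = (SUP f\<in>E. squeezing_at D f)"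
    unfolding s_def squeezing_function_def E_def by (simp add: setcompr_eq_image)
  have E: "f ` D \<subseteq> ball 0 1" "holomorphic_map_on f D" "inj_on f D" "open (f ` D)" "f x = 0"
    if "f \<in> E" for f
    using that D(1) by (auto simp: E_def holomorphic_embedding_def)
  define A where "A = (\<lambda>f :: complex ^ 'n \<Rightarrow> complex ^ 'n. {r. 0 < r \<and> ball 0 r \<subseteq> f ` D})"
  have sq: "squeezing_at D f = Sup (A f)" for f
    by (simp add: squeezing_at_def A_def)
  have A_nonempty: "A f \<noteq> {}" if "f \<in> E" for f
  proof -
    have "0 \<in> f ` D" using E(5)[OF that] assms(2) by force
    then show ?thesis
      using E(4)[OF that] open_contains_ball unfolding A_def by blast
  qed
  have A_le: "r \<le> 1" if "f \<in> E" "r \<in> A f" for f r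
  proof -
    have "ball (0 :: complex ^ 'n) r \<subseteq> ball 0 1"
      using that E(1)[OF that(1)] unfolding A_def by (blast intro: order_trans)
    then show ?thesis
      using that by (auto simp: A_def ball_subset_ball_iff)
  qed
  have "E \<noteq> {}"
    using holomorphic_embedding_exists[OF assms] by (auto simp: E_def)
  \<comment> \<open>A real \<open>Sup\<close> is informative only for nonempty sets bounded above,
    so both properties are secured for the inner and the outer supremum.\<close>
  have bdd: "bdd_above (squeezing_at D ` E)"
    unfolding sq using A_nonempty A_le by (intro bdd_aboveI2[where M = 1] cSup_least) auto
  have radius: "\<exists>f\<in>E. ball 0 t \<subseteq> f ` D" if "t < s" for t
  proof -
    obtain f where f: "f \<in> E" "t < squeezing_at D f"
      using less_cSupD[of "squeezing_at D ` E" t] \<open>E \<noteq> {}\<close> \<open>t < s\<close> unfolding s_eq by blast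
    then obtain r where "r \<in> A f" "t < r"
      using less_cSupD[OF A_nonempty[OF f(1)]] unfolding sq by blast
    then show ?thesis
      using f(1) by (auto simp: A_def intro!: bexI[of _ f])
  qed
  have s_pos: "s > 0"
  proof -
    obtain f where f: "f \<in> E" using \<open>E \<noteq> {}\<close> by blast
    obtain r where r: "r \<in> A f" using A_nonempty[OF f] by blast
    have "r \<le> squeezing_at D f"
      unfolding sq using r A_le[OF f] by (intro cSup_upper bdd_aboveI[of _ 1]) auto
    also have "\<dots> \<le> s"
      unfolding s_eq by (rule cSUP_upper[OF f bdd])
    finally show ?thesis
      using r by (simp add: A_def)
  qed
  \<comment> \<open>For small \<open>n\<close> the radius may be negative; the ball is then
    empty.\<close>
  have "\<forall>n. \<exists>f\<in>E. ball 0 (s - inverse (real (Suc n))) \<subseteq> f ` D"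
    using radius by simp
  then obtain F0 where F0: "\<And>n. F0 n \<in> E" "\<And>n. ball 0 (s - inverse (real (Suc n))) \<subseteq> F0 n ` D"
    by metis
  have "norm (F0 n z) \<le> 1" if "z \<in> D" for n z
    using E(1)[OF F0(1)[of n]] that by (force simp: less_imp_le)
  then obtain k f where k: "strict_mono (k :: nat \<Rightarrow> nat)" and lim0: "loc_unif (\<lambda>n. F0 (k n)) f D"
    by (rule montel_maps[OF D(1) E(2)[OF F0(1)], where B = 1])
  define F where "F = (\<lambda>n. F0 (k n))"
  have F: "F n \<in> E" for n
    by (simp add: F_def F0)
  have lim: "loc_unif F f D"
    unfolding F_def by (rule lim0)
  \<comment> \<open>A fixed \<open>t < s\<close> is below the covering radius of all late maps, and
    dropping the first \<open>m\<close> terms leaves the limit \<open>f\<close> unchanged.\<close>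
  have covers: "ball 0 t \<subseteq> f ` D \<and> det (jac f x) \<noteq> 0" if t: "0 < t" "t < s" for t
  proof -
    obtain m where m: "inverse (real (Suc m)) < s - t"
      using reals_Archimedean[of "s - t"] t by auto
    have "ball 0 t \<subseteq> F (n + m) ` D" for n
    proof -
      have "m \<le> k (n + m)"
        using seq_suble[OF k, of "n + m"] by simp
      then have "inverse (real (Suc (k (n + m)))) \<le> inverse (real (Suc m))"
        by (intro le_imp_inverse_le) auto
      then have "t \<le> s - inverse (real (Suc (k (n + m))))"
        using m by linarith
      then show ?thesis
        using F0(2)[of "k (n + m)"] subset_ball unfolding F_def by blast
    qed
    moreover have "loc_unif (\<lambda>n. F (n + m)) f D"
      by (rule loc_unif_subseq[OF lim]) (simp add: strict_mono_def)
    ultimately show ?thesis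
      using limit_covers_ball[where F = "\<lambda>n. F (n + m)", OF D(1,3) E(2)[OF F] E(3)[OF F]
            assms(2) E(5)[OF F] t(1)] by simp
  qed
  have det: "det (jac f x) \<noteq> 0"
    using covers[of "s / 2"] s_pos by simp
  have hol: "holomorphic_map_on f D"
    by (rule loc_unif_holomorphic_map_on[OF lim D(1) E(2)[OF F]])
  note cont = holomorphic_map_on_continuous_on[OF hol]
  have inj: "inj_on f D"
    by (rule limit_of_injective_maps(1)[OF D(1,2) E(2)[OF F] E(3)[OF F] lim assms(2) det])
  have opn: "open (f ` U)" if "U \<subseteq> D" "open U" for U
    by (rule invariance_of_domain[OF continuous_on_subset[OF cont that(1)] that(2)
          inj_on_subset[OF inj that(1)]])
  have "f ` D \<subseteq> cball 0 1"
  proof clarify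
    fix z assume z: "z \<in> D"
    have "norm (F n z) \<le> 1" for n
      using E(1)[OF F[of n]] z by (force simp: less_imp_le)
    then have "norm (f z) \<le> 1"
      using Lim_bounded[OF tendsto_norm[OF loc_unif_tendsto[OF lim z]]] by blast
    then show "f z \<in> cball 0 1" by simp
  qed
  \<comment> \<open>The limit only stays in the closed ball, but its image is open and so lies in
    the interior.\<close>
  then have "f ` D \<subseteq> interior (cball 0 1)"
    using opn[OF order_refl D(1)] by (intro interior_maximal)
  then have sub: "f ` D \<subseteq> ball 0 1"
    by simp
  have f0: "f x = 0"
    using loc_unif_tendsto[OF lim assms(2)] by (simp add: E(5)[OF F] LIMSEQ_const_iff)
  \<comment> \<open>The open ball of radius \<open>s\<close> is exhausted by the balls of radius
    \<open>t < s\<close>, so the supremum itself is reached.\<close>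
  have "ball 0 s \<subseteq> f ` D"
  proof
    fix w assume "w \<in> ball (0 :: complex ^ 'n) s"
    then have "norm w < s" by simp
    then obtain t where t: "norm w < t" "t < s"
      using dense by blast
    then have "w \<in> ball 0 t" "0 < t"
      using norm_ge_zero[of w] by (simp, linarith)
    then show "w \<in> f ` D"
      using covers[of t] t by blast
  qed
  then show ?thesis
    using sub hol inj opn f0 unfolding holomorphic_embedding_def s_def by blast
qed

end
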